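(* Let $(G_n)_{n\ge 0}$ be the rock-paper-scissors preferential attachment process with $m=2$ (started from a fixed finite typed graph $G_0$ in which each of the three types has positive total degree). Let $X_n,Y_n,Z_n$ be the total degrees in $G_n$ of the vertices of types $1,2,3$ respectively, each divided by the total degree of $G_n$ (so $X_n+Y_n+Z_n=1$), and let $M_n=X_nY_nZ_n$. Then the process $(M_n)_{n\in\mathbb{N}}$ almost surely converges to a (random) limit $M\in(0,1/27)$, and the distribution of $M$ has full support on $(0,1/27)$. Furthermore, almost surely $(X_n,Y_n,Z_n)$ fails to converge as $n\to\infty$; rather, almost surely its limit set is the set $\{(x,y,z)\in\Delta^2: xyz=M\}$.
   Context: Here $\Delta^2=\{(x,y,z)\in\mathbb{R}^3: x,y,z\ge 0,\ x+y+z=1\}$. Rock-paper-scissors preferential attachment process: each vertex has one of three types $1$ ("rock"), $2$ ("paper"), $3$ ("scissors"), fixed once assigned. Start from a fixed finite graph $G_0$ whose vertices have assigned types, such that each type has positive total degree in $G_0$. For each $n\ge 1$, given $G_{n-1}$, choose two vertices of $G_{n-1}$ independently and with replacement, each with probability proportional to degree in $G_{n-1}$. Form $G_n$ by adding a new vertex joined by two edges to the two chosen vertices (a double edge if the same vertex is chosen twice). If the two chosen vertices have the same type, the new vertex takes that type; if they have types $\{1,2\}$ the new vertex has type $2$; if $\{2,3\}$ it has type $3$; if $\{1,3\}$ it has type $1$. The limit set of a sequence in $\Delta^2$ is the set of all limits of its convergent subsequences. The distribution of $M$ having full support on $(0,1/27)$ means that $\mathbb{P}(M\in I)>0$ for every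 nonempty open interval $I\subseteq(0,1/27)$. *)

theory Defs
  imports "HOL-Probability.Probability" "HOL-Library.Multiset"
begin

datatype rps = Rock | Paper | Scissors

fun winner :: "rps \<Rightarrow> rps \<Rightarrow> rps" where
  "winner Rock Rock = Rock"
| "winner Paper Paper = Paper"
| "winner Scissors Scissors = Scissors"
| "winner Rock Paper = Paper"
| "winner Paper Rock = Paper"
| "winner Paper Scissors = Scissors"
| "winner Scissors Paper = Scissors"
| "winner Scissors Rock = Rock"
| "winner Rock Scissors = Rock"

text \<open>
  Finite typed undirected multigraphs. The vertices are the indices into the list of types, and
  an edge is the two-element multiset of its endpoints, so that a loop at \<open>v\<close> is \<open>{#v, v#}\<close>
  and contributes 2 to the degree of \<open>v\<close>.
\<close>

datatype typed_graph = TGraph (vtypes: "rps list") (edges: "nat multiset multiset")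

definition verts :: "typed_graph \<Rightarrow> nat set" where
  "verts g = {..<length (vtypes g)}"

definition wf_graph :: "typed_graph \<Rightarrow> bool" where
  "wf_graph g \<longleftrightarrow> (\<forall>e \<in># edges g. size e = 2 \<and> set_mset e \<subseteq> verts g)"

definition degree :: "typed_graph \<Rightarrow> nat \<Rightarrow> nat" where
  "degree g v = (\<Sum>e\<in>#edges g. count e v)"

definition total_degree :: "typed_graph \<Rightarrow> nat" where
  "total_degree g = (\<Sum>v\<in>verts g. degree g v)"

definition type_degree :: "typed_graph \<Rightarrow> rps \<Rightarrow> nat" where
  "type_degree g t = (\<Sum>v | v \<in> verts g \<and> vtypes g ! v = t. degree g v)"

definition share :: "typed_graph \<Rightarrow> rps \<Rightarrow> real" where
  "share g t = real (type_degree g t) / real (total_degree g)"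

text \<open>
  The following is a proper distribution whenever \<open>g\<close> is well-formed and has at least one edge
  (lemma \<open>pmf_choose_vertex\<close>).
\<close>

definition choose_vertex :: "typed_graph \<Rightarrow> nat pmf" where
  "choose_vertex g = embed_pmf (\<lambda>v. real (degree g v) / real (total_degree g))"

lemma degree_eq_0:
  assumes "wf_graph g" "v \<notin> verts g"
  shows "degree g v = 0"
  using assms by (auto simp: degree_def wf_graph_def subset_iff count_eq_zero_iff)

lemma pmf_choose_vertex:
  assumes "wf_graph g" "total_degree g > 0"
  shows "pmf (choose_vertex g) v = real (degree g v) / real (total_degree g)"
  unfolding choose_vertex_def
proof (rule pmf_embed_pmf)
  let ?f = "\<lambda>v. real (degree g v) / real (total_degree g)"
  have "(\<integral>\<^sup>+ v. ennreal (?f v) \<partial>count_space UNIV) = (\<Sum>v\<in>verts g. ennreal (?f v))"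
    by (rule nn_integral_count_space') (auto simp: verts_def degree_eq_0[OF assms(1)])
  also have "\<dots> = ennreal (\<Sum>v\<in>verts g. ?f v)"
    by (rule sum_ennreal) auto
  also have "(\<Sum>v\<in>verts g. ?f v) = 1"
    using assms(2) by (simp add: total_degree_def flip: sum_divide_distrib of_nat_sum)
  finally show "(\<integral>\<^sup>+ v. ennreal (?f v) \<partial>count_space UNIV) = 1" by simp
qed auto

definition attach :: "typed_graph \<Rightarrow> nat \<times> nat \<Rightarrow> typed_graph" where
  "attach g = (\<lambda>(u, v). TGraph
     (vtypes g @ [winner (vtypes g ! u) (vtypes g ! v)])
     (edges g + {# {#length (vtypes g), u#}, {#length (vtypes g), v#} #}))"

definition rps_step :: "typed_graph \<Rightarrow> typed_graph pmf" where
  "rps_step g = map_pmf (attach g) (pair_pmf (choose_vertex g) (choose_vertex g))"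

text \<open>
  The last conjunct says that, conditionally on \<open>G 0, \<dots>, G n\<close>, the graph \<open>G (Suc n)\<close> has law
  \<open>rps_step (G n)\<close>; all random variables being discrete, this is stated on the individual
  finite histories \<open>h 0, \<dots>, h (Suc n)\<close>.
\<close>

definition rps_process ::
    "'w measure \<Rightarrow> typed_graph \<Rightarrow> (nat \<Rightarrow> 'w \<Rightarrow> typed_graph) \<Rightarrow> bool" where
  "rps_process P G0 G \<longleftrightarrow>
     prob_space P \<and>
     (\<forall>n. G n \<in> measurable P (count_space UNIV)) \<and>
     (AE \<omega> in P. G 0 \<omega> = G0) \<and>
     (\<forall>n h. measure P {\<omega> \<in> space P. \<forall>i\<le>Suc n. G i \<omega> = h i} =
            measure P {\<omega> \<in> space P. \<forall>i\<le>n. G i \<omega> = h i} * pmf (rps_step (h n)) (h (Suc n)))"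

definition simplex2 :: "(real \<times> real \<times> real) set" where
  "simplex2 = {(x, y, z). 0 \<le> x \<and> 0 \<le> y \<and> 0 \<le> z \<and> x + y + z = 1}"

definition limit_set :: "(nat \<Rightarrow> 'a::topological_space) \<Rightarrow> 'a set" where
  "limit_set s = {l. \<exists>r. strict_mono r \<and> (s \<circ> r) \<longlonglongrightarrow> l}"

definition shares :: "typed_graph \<Rightarrow> real \<times> real \<times> real" where
  "shares g = (share g Rock, share g Paper, share g Scissors)"

end

theory Submission
  imports Defs "HOL-Real_Asymp.Real_Asymp"
begin

text \<open>
  Only the total degrees \<open>a\<close>, \<open>b\<close>, \<open>c\<close> of the three types matter: they form an urn whose total \<open>t\<close>
  grows by 4 in each step. Write \<open>x\<close>, \<open>y\<close>, \<open>z\<close> for the shares and \<open>level a b c\<close> for the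
  product \<open>xyz\<close>. A computation gives two exact formulas (\<open>avg_share\<close>, \<open>avg_level\<close>): the shares have
  the mean drift \<open>2x(z - y)/(t + 4)\<close>, and cyclically, whose orbits are the level curves of \<open>xyz\<close>; and
  \<open>xyz\<close> itself is multiplied on average by \<open>1 - O(1/t\<^sup>2)\<close>.

  Convergence. The increments of bounded smooth functions of the shares are \<open>O(1/n)\<close>, so their
  martingale parts are orthogonal with summable variances. Summing over the blocks between
  consecutive cubes makes the block sums summable in \<open>L\<^sup>1\<close>, while inside a block everything moves by
  \<open>O(1/k)\<close>; so no maximal inequality is needed (\<open>orthogonal_series_summable\<close>). This gives the limit
  \<open>Mlim\<close> of \<open>xyz\<close>, and the convergence of the accumulated noise of the shares.

  All other estimates come from functions of the state whose average does not increase
  (\<open>supermart\<close>), passed to the limit by \<open>limit_expectation\<close>.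
  The function \<open>4/a + 4/b + 4/c - ln (xyz)\<close> has this property, so the mean of \<open>- ln (xyz)\<close> stays bounded
  and \<open>Mlim > 0\<close>. The delicate point is \<open>Mlim < 1/27\<close>, that is, the centre of the simplex is not
  a limit. With the gap \<open>s = 1/27 - xyz + 1/t\<close>, the conditional mean of \<open>1/27 - Mlim\<close> is at least
  \<open>s/27\<close>, because the drift of \<open>xyz\<close> is negative, and the conditional second moment is at most a constant
  times \<open>s\<^sup>2\<close>, because close to the centre \<open>xyz\<close> is almost stationary. Hence from any state
  \<open>Mlim \<noteq> 1/27\<close> has conditional probability at least some absolute constant (\<open>escape_centre\<close>), and as
  \<open>Mlim\<close> is approximated by functions of the past, this forces probability 1.

  Full support. Steps in which a type is chosen twice steer the urn, with positive probability,
  to any proportions at late times, and from there the conditional variance of \<open>Mlim\<close> is \<open>O(1/t)\<close>.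

  Limit set. Adding to the shares the tail of the convergent noise makes the recursion
  deterministic up to vanishing errors in the drift. Around the centre the drift turns at a rate
  bounded below near the limiting level curve, the angle
  increases to infinity like a harmonic series, and its increments vanish, so every direction is
  approached infinitely often (\<open>rotating_sequence_directions\<close>). A level curve meets each ray from
  the centre at most once, which turns directions into points (\<open>limit_set_rotation\<close>).
\<close>

section \<open>The average over one step of the urn\<close>

text \<open>
  The mean of \<open>h i j k\<close> over the random increments \<open>(i, j, k)\<close> of the type degrees in one step from
  the degrees \<open>(a, b, c)\<close> of rock, paper, scissors: both chosen types gain 1 and the winner
  gains 2 more. Real arguments keep the algebra free of coercions.
\<close>
definition avg :: "real \<Rightarrow> real \<Rightarrow> real \<Rightarrow> (real \<Rightarrow> real \<Rightarrow> real \<Rightarrow> real) \<Rightarrow> real" where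
  "avg a b c h = (a\<^sup>2 * h 4 0 0 + b\<^sup>2 * h 0 4 0 + c\<^sup>2 * h 0 0 4
     + 2*a*b * h 1 3 0 + 2*b*c * h 0 1 3 + 2*c*a * h 3 0 1) / (a+b+c)\<^sup>2"

text \<open>
  The increments that can occur in one step.
\<close>
definition move :: "real \<Rightarrow> real \<Rightarrow> real \<Rightarrow> bool" where
  "move i j k \<longleftrightarrow> (i, j, k) \<in> {(4,0,0), (0,4,0), (0,0,4), (1,3,0), (0,1,3), (3,0,1)}"

text \<open>
  The product of the three shares.
\<close>
definition level :: "real \<Rightarrow> real \<Rightarrow> real \<Rightarrow> real" where
  "level a b c = a * b * c / (a+b+c)^3"

lemma moveD:
  assumes "move i j k"
  shows "0 \<le> i" "0 \<le> j" "0 \<le> k" "i \<le> 4" "j \<le> 4" "k \<le> 4" "i + j + k = 4" "k = 4 - i - j"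
  using assms by (auto simp: move_def)

lemma avg_mono:
  assumes "0 \<le> a" "0 \<le> b" "0 \<le> c"
    and "\<And>i j k. move i j k \<Longrightarrow> h i j k \<le> h' i j k"
  shows "avg a b c h \<le> avg a b c h'"
  unfolding avg_def using assms
  by (intro divide_right_mono add_mono mult_left_mono) (auto simp: move_def)

lemma avg_cong:
  assumes "\<And>i j k. move i j k \<Longrightarrow> h i j k = h' i j k"
  shows "avg a b c h = avg a b c h'"
  unfolding avg_def using assms by (simp add: move_def)

lemma avg_add: "avg a b c (\<lambda>i j k. h i j k + h' i j k) = avg a b c h + avg a b c h'"
  by (simp add: avg_def add_divide_distrib[symmetric] algebra_simps)

lemma avg_cmult: "avg a b c (\<lambda>i j k. r * h i j k) = r * avg a b c h"
  by (simp add: avg_def algebra_simps)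

lemma avg_const:
  assumes "a + b + c \<noteq> 0"
  shows "avg a b c (\<lambda>i j k. r) = r"
proof -
  have "a\<^sup>2 * r + b\<^sup>2 * r + c\<^sup>2 * r + 2*a*b*r + 2*b*c*r + 2*c*a*r = r * (a+b+c)\<^sup>2"
    by (simp add: power2_eq_square algebra_simps)
  then show ?thesis using assms by (simp add: avg_def)
qed

lemma avg_diff: "avg a b c (\<lambda>i j k. h i j k - h' i j k) = avg a b c h - avg a b c h'"
  using avg_add[of a b c h "\<lambda>i j k. (-1) * h' i j k"] avg_cmult[of a b c "-1" h'] by simp

lemma avg_i:
  assumes "a + b + c \<noteq> 0"
  shows "avg a b c (\<lambda>i j k. i) = 2 * a * (2 * a + b + 3 * c) / (a+b+c)\<^sup>2"
  by (simp add: avg_def power2_eq_square algebra_simps)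

lemma avg_j:
  assumes "a + b + c \<noteq> 0"
  shows "avg a b c (\<lambda>i j k. j) = 2 * b * (2 * b + c + 3 * a) / (a+b+c)\<^sup>2"
  by (simp add: avg_def power2_eq_square algebra_simps)

lemma avg_k:
  assumes "a + b + c \<noteq> 0"
  shows "avg a b c (\<lambda>i j k. k) = 2 * c * (2 * c + a + 3 * b) / (a+b+c)\<^sup>2"
  by (simp add: avg_def power2_eq_square algebra_simps)

lemma avg_rot: "avg a b c h = avg b c a (\<lambda>j k i. h i j k)"
  by (simp add: avg_def algebra_simps)

text \<open>
  For the unnormalised product the average is exactly \<open>abc (t\<^sup>2 + 12 t + 18) / t\<^sup>2\<close>: the terms of
  first order in the increments sum to \<open>12 abc / t\<close>, which is also the relative growth \<open>12 / t\<close> of \<open>t\<^sup>3\<close>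
  to first order, and so they cancel upon normalising.
\<close>
lemma avg_level:
  assumes "0 < a" "0 < b" "0 < c"
  defines "t \<equiv> a + b + c"
  shows "avg a b c (\<lambda>i j k. level (a+i) (b+j) (c+k)) = level a b c * (1 - (30*t+64)/(t+4)^3)"
proof -
  have t: "t > 0" using assms by simp
  have "avg a b c (\<lambda>i j k. level (a+i) (b+j) (c+k))
      = avg a b c (\<lambda>i j k. inverse ((t+4)^3) * ((a+i) * (b+j) * (c+k)))"
  proof (rule avg_cong)
    fix i j k assume "move i j k"
    then have "(a+i) + (b+j) + (c+k) = t + 4" using moveD(7)[of i j k] by (simp add: t_def)
    then show "level (a+i) (b+j) (c+k) = inverse ((t+4)^3) * ((a+i) * (b+j) * (c+k))"
      by (simp add: level_def divide_inverse)
  qed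
  also have "\<dots> = avg a b c (\<lambda>i j k. (a+i) * (b+j) * (c+k)) / (t+4)^3"
    by (simp only: avg_cmult) (simp add: divide_inverse)
  also have "avg a b c (\<lambda>i j k. (a+i) * (b+j) * (c+k)) = a * b * c * (t\<^sup>2 + 12*t + 18) / t\<^sup>2"
    unfolding avg_def t_def[symmetric]
    by (rule arg_cong[where f="\<lambda>u. u / t\<^sup>2"]) (unfold t_def, algebra)
  also have "a * b * c * (t\<^sup>2 + 12*t + 18) / t\<^sup>2 / (t+4)^3 = level a b c * (1 - (30*t+64)/(t+4)^3)"
  proof -
    have "1 - (30*t+64)/(t+4)^3 = t * (t\<^sup>2 + 12*t + 18) / (t+4)^3"
    proof -
      have "t * (t\<^sup>2 + 12*t + 18) + (30*t+64) = (t+4)^3" by algebra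
      moreover have "(t+4)^3 \<noteq> 0" using t by simp
      ultimately show ?thesis by (simp add: eq_divide_eq left_diff_distrib)
    qed
    moreover have "level a b c = a * b * c / t^3" by (simp add: level_def t_def)
    ultimately show ?thesis using t by (simp add: power2_eq_square power3_eq_cube)
  qed
  finally show ?thesis .
qed

lemma avg_share:
  assumes "0 < a" "0 < b" "0 < c"
  defines "t \<equiv> a + b + c"
  shows "avg a b c (\<lambda>i j k. (a+i) / ((a+i)+(b+j)+(c+k))) - a/t = 2 * (a/t) * (c/t - b/t) / (t+4)"
proof -
  have t: "t > 0" using assms by simp
  have "avg a b c (\<lambda>i j k. (a+i) / ((a+i)+(b+j)+(c+k))) = avg a b c (\<lambda>i j k. inverse (t+4) * (a+i))"
  proof (rule avg_cong)
    fix i j k assume "move i j k"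
    then have "(a+i) + (b+j) + (c+k) = t + 4" using moveD(7)[of i j k] by (simp add: t_def)
    then show "(a+i) / ((a+i)+(b+j)+(c+k)) = inverse (t+4) * (a+i)"
      by (simp add: divide_inverse)
  qed
  also have "\<dots> = (a + 2 * a * (2 * a + b + 3 * c) / t\<^sup>2) / (t+4)"
    using t unfolding t_def by (simp only: avg_cmult avg_add avg_const avg_i) (simp add: divide_inverse)
  also have "\<dots> - a/t = 2 * (a/t) * (c/t - b/t) / (t+4)"
  proof -
    have "2 * a * (2 * a + b + 3 * c) = 2 * a * (2 * t + c - b)" by (simp add: t_def algebra_simps)
    then have "(a + 2 * a * (2 * a + b + 3 * c) / t\<^sup>2) / (t+4) - a/t
        = (a + 2 * a * (2 * t + c - b) / t\<^sup>2) / (t+4) - a/t" by (simp only:)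
    also have "\<dots> = 2 * (a/t) * (c/t - b/t) / (t+4)"
    proof -
      have "t \<noteq> 0" "t + 4 \<noteq> 0" using t by auto
      then show ?thesis by (simp add: divide_simps power2_eq_square) (simp add: algebra_simps)
    qed
    finally show ?thesis .
  qed
  finally show ?thesis .
qed

text \<open>
  The distance of \<open>xyz\<close> from its maximum in terms of the distance from the centre of the simplex
  and of the angular momentum of the drift about the centre.
\<close>
lemma gap_identity:
  fixes x y z :: real
  assumes "x + y + z = 1"
  shows "1/27 - x*y*z = ((x-y)\<^sup>2 + (y-z)\<^sup>2 + (z-x)\<^sup>2) / 54
    + (x * (y-z)\<^sup>2 + y * (z-x)\<^sup>2 + z * (x-y)\<^sup>2) / 9"
proof -
  have z: "z = 1 - x - y" using assms by simp
  show ?thesis unfolding z by (simp add: field_simps power2_eq_square)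
qed

lemma gap_ge:
  fixes x y z :: real
  assumes "x + y + z = 1" "0 \<le> x" "0 \<le> y" "0 \<le> z"
  shows "(x-y)\<^sup>2 + (y-z)\<^sup>2 + (z-x)\<^sup>2 \<le> 54 * (1/27 - x*y*z)"
proof -
  have "0 \<le> x * (y-z)\<^sup>2 + y * (z-x)\<^sup>2 + z * (x-y)\<^sup>2" using assms by simp
  then show ?thesis unfolding gap_identity[OF assms(1)] by argo
qed

lemma level_shares: "level a b c = (a/(a+b+c)) * (b/(a+b+c)) * (c/(a+b+c))"
  by (simp add: level_def power3_eq_cube)

lemma level_bounds:
  assumes "0 < a" "0 < b" "0 < c"
  shows "0 < level a b c" "level a b c \<le> 1/27"
proof -
  show "0 < level a b c" using assms by (simp add: level_def)
  have "0 \<le> 54 * (1/27 - level a b c)"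
    unfolding level_shares using assms
    by (intro order_trans[OF _ gap_ge]) (auto simp: add_divide_distrib[symmetric])
  then show "level a b c \<le> 1/27" by simp
qed

lemma share_step_le:
  assumes "0 < a" "0 < b" "0 < c" "move i j k"
  shows "\<bar>(a+i) / ((a+i)+(b+j)+(c+k)) - a/(a+b+c)\<bar> \<le> 4 / (a+b+c)"
proof -
  define t where "t = a + b + c"
  have t: "t > 0" "a \<le> t" using assms by (auto simp: t_def)
  have "(a+i)+(b+j)+(c+k) = t+4" using moveD(7)[OF assms(4)] by (simp add: t_def)
  moreover have "(a+i)/(t+4) - a/t = (i - 4 * (a/t)) / (t+4)" using t by (simp add: field_simps)
  moreover have "\<bar>i - 4 * (a/t)\<bar> \<le> 4"
  proof -
    have "0 \<le> a/t" "a/t \<le> 1" using t assms by auto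
    then show ?thesis using moveD[OF assms(4)] by (auto simp: abs_le_iff)
  qed
  ultimately have "\<bar>(a+i) / ((a+i)+(b+j)+(c+k)) - a/t\<bar> \<le> 4 / (t+4)"
    using t by (simp add: abs_divide divide_right_mono)
  also have "\<dots> \<le> 4 / t" using t by (intro divide_left_mono) auto
  finally show ?thesis by (simp add: t_def)
qed

text \<open>
  The second bound is the sharper one near the centre, where the gradient of \<open>xyz\<close> on the simplex
  vanishes like the square root of \<open>1/27 - xyz\<close>.
\<close>
lemma level_step:
  assumes "0 < a" "0 < b" "0 < c" "move i j k" "1 \<le> a + b + c"
  defines "t \<equiv> a + b + c"
  shows "\<bar>level (a+i) (b+j) (c+k) - level a b c\<bar> \<le> 12 / t"
    and "(level (a+i) (b+j) (c+k) - level a b c)\<^sup>2 \<le> 3456 * (1/27 - level a b c) / t\<^sup>2 + 2048 / t^4"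
proof -
  define x y z where xyz: "x = a/t" "y = b/t" "z = c/t"
  define T where "T = (a+i)+(b+j)+(c+k)"
  define p q r where pqr: "p = (a+i)/T - x" "q = (b+j)/T - y" "r = (c+k)/T - z"
  have t: "t \<ge> 1" using assms by simp
  have T: "T = t + 4" using moveD(7)[OF assms(4)] by (simp add: T_def t_def)
  have xyz1: "0 \<le> x" "0 \<le> y" "0 \<le> z" "x + y + z = 1"
    using assms t by (auto simp: xyz t_def add_divide_distrib[symmetric])
  then have xyz2: "x \<le> 1" "y \<le> 1" "z \<le> 1" by auto
  have "(a+i)/T + (b+j)/T + (c+k)/T = 1"
    using T t unfolding add_divide_distrib[symmetric] by (simp add: T_def)
  \<comment> \<open>The increments of the shares sum to 0, so that only differences of shares enter the linear part \<open>u\<close>.\<close>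
  then have r: "r = - p - q" using xyz1 by (simp add: pqr)
  have "i \<ge> 0" "j \<ge> 0" "k \<ge> 0" using moveD[OF assms(4)] by auto
  then have n0: "0 \<le> x + p" "0 \<le> y + q" "0 \<le> z + r"
    using assms T t by (auto simp: pqr)
  then have n1: "x + p \<le> 1" "y + q \<le> 1" "z + r \<le> 1" using r xyz1 by auto
  have p: "\<bar>p\<bar> \<le> 4/t"
    using share_step_le[OF assms(1-4)] by (simp add: pqr xyz T_def t_def)
  have q: "\<bar>q\<bar> \<le> 4/t"
    using share_step_le[of b c a j k i] assms(1-4)
    by (simp add: pqr xyz T_def t_def algebra_simps move_def) fastforce
  have rr: "\<bar>r\<bar> \<le> 4/t"
    using share_step_le[of c a b k i j] assms(1-4)
    by (simp add: pqr xyz T_def t_def algebra_simps move_def) fastforce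
  have m0: "level a b c = x * y * z" by (simp add: level_shares xyz t_def)
  have m1: "level (a+i) (b+j) (c+k) = (x+p) * (y+q) * (z+r)"
    by (simp add: level_shares pqr T_def)
  have "(x+p) * (y+q) * (z+r) - x*y*z = p * ((y+q) * (z+r)) + q * (x * (z+r)) + r * (x * y)"
    by (simp add: algebra_simps)
  also have "\<bar>\<dots>\<bar> \<le> \<bar>p\<bar> * 1 + \<bar>q\<bar> * 1 + \<bar>r\<bar> * 1"
    using xyz1 xyz2 n0 n1
    by (intro order_trans[OF abs_triangle_ineq] add_mono)
       (auto simp: abs_mult intro!: mult_left_le mult_le_one)
  finally show "\<bar>level (a+i) (b+j) (c+k) - level a b c\<bar> \<le> 12 / t"
    unfolding m0 m1 using p q rr by simp
  define u where "u = y * (z - x) * p + x * (z - y) * q"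
  define v where "v = x * q * r + y * p * r + z * p * q + p * q * r"
  have e: "(x+p) * (y+q) * (z+r) - x*y*z = u + v"
    unfolding u_def v_def r by (simp add: algebra_simps)
  have pq: "\<bar>g * h\<bar> \<le> 16/t\<^sup>2" if "\<bar>g\<bar> \<le> 4/t" "\<bar>h\<bar> \<le> 4/t" for g h :: real
    using mult_mono[OF that] t by (simp add: abs_mult power2_eq_square)
  have "\<bar>v\<bar> \<le> x * (16/t\<^sup>2) + y * (16/t\<^sup>2) + z * (16/t\<^sup>2) + 16/t\<^sup>2 * 1"
  proof -
    have "\<bar>r\<bar> \<le> 1" using n0 n1 xyz1 xyz2 by (simp add: abs_le_iff)
    then have "\<bar>p * q * r\<bar> \<le> 16/t\<^sup>2 * 1"
      using pq[OF p q] unfolding abs_mult[of "p*q"] by (intro mult_mono) auto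
    moreover have "\<bar>x * q * r\<bar> \<le> x * (16/t\<^sup>2)"
      using mult_left_mono[OF pq[OF q rr] xyz1(1)] xyz1(1) by (simp add: abs_mult mult.assoc)
    moreover have "\<bar>y * p * r\<bar> \<le> y * (16/t\<^sup>2)"
      using mult_left_mono[OF pq[OF p rr] xyz1(2)] xyz1(2) by (simp add: abs_mult mult.assoc)
    moreover have "\<bar>z * p * q\<bar> \<le> z * (16/t\<^sup>2)"
      using mult_left_mono[OF pq[OF p q] xyz1(3)] xyz1(3) by (simp add: abs_mult mult.assoc)
    ultimately show ?thesis unfolding v_def by linarith
  qed
  also have "\<dots> = 32/t\<^sup>2" using xyz1(4) by (simp add: algebra_simps flip: distrib_left add_divide_distrib)
  finally have v: "v\<^sup>2 \<le> (32/t\<^sup>2)\<^sup>2" using abs_le_square_iff[of v "32/t\<^sup>2"] by simp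
  have lin: "\<bar>g * d * f\<bar> \<le> \<bar>d\<bar> * (4/t)" if "0 \<le> g" "g \<le> 1" "\<bar>f\<bar> \<le> 4/t" for g d f :: real
    using mult_mono[OF that(2) mult_left_mono[OF that(3), of "\<bar>d\<bar>"]] that(1)
    by (simp add: abs_mult mult.assoc)
  have "\<bar>u\<bar> \<le> \<bar>z - x\<bar> * (4/t) + \<bar>z - y\<bar> * (4/t)"
    unfolding u_def using p q xyz1 xyz2
    by (intro order_trans[OF abs_triangle_ineq] add_mono lin) auto
  also have "\<dots> = (\<bar>z - x\<bar> + \<bar>z - y\<bar>) * (4/t)" by (simp add: algebra_simps)
  finally have "u\<^sup>2 \<le> ((\<bar>z - x\<bar> + \<bar>z - y\<bar>) * (4/t))\<^sup>2"
    using abs_le_square_iff[of u "(\<bar>z - x\<bar> + \<bar>z - y\<bar>) * (4/t)"] t by (simp add: abs_mult)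
  also have "\<dots> = (\<bar>z - x\<bar> + \<bar>z - y\<bar>)\<^sup>2 * (16/t\<^sup>2)"
    by (simp only: power_mult_distrib power_divide) simp
  also have "\<dots> \<le> (2 * (54 * (1/27 - x*y*z))) * (16/t\<^sup>2)"
  proof (rule mult_right_mono)
    have "(\<bar>z - x\<bar> + \<bar>z - y\<bar>)\<^sup>2 \<le> 2 * ((z-x)\<^sup>2 + (y-z)\<^sup>2)"
      using sum_squares_bound[of "\<bar>z-x\<bar>" "\<bar>z-y\<bar>"]
      by (simp add: power2_sum power2_commute[of y z])
    also have "\<dots> \<le> 2 * (54 * (1/27 - x*y*z))"
      using gap_ge[OF xyz1(4,1,2,3)] zero_le_power2[of "x-y"] by argo
    finally show "(\<bar>z - x\<bar> + \<bar>z - y\<bar>)\<^sup>2 \<le> 2 * (54 * (1/27 - x*y*z))" .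
  qed simp
  finally have u: "u\<^sup>2 \<le> 1728 * (1/27 - x*y*z) / t\<^sup>2" by argo
  have "(u+v)\<^sup>2 \<le> 2 * u\<^sup>2 + 2 * v\<^sup>2" using sum_squares_bound[of u v] by (simp add: power2_sum)
  also have "\<dots> \<le> 2 * (1728 * (1/27 - x*y*z) / t\<^sup>2) + 2 * (32/t\<^sup>2)\<^sup>2"
    using u v by (intro add_mono mult_left_mono) auto
  also have "\<dots> = 3456 * (1/27 - level a b c) / t\<^sup>2 + 2048 / t^4"
    by (simp add: m0 power_divide flip: power_mult)
  finally show "(level (a+i) (b+j) (c+k) - level a b c)\<^sup>2
      \<le> 3456 * (1/27 - level a b c) / t\<^sup>2 + 2048 / t^4"
    unfolding m0 m1 e by simp
qed

section \<open>Supermartingale functions of the urn\<close>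

lemma move_sum: "move i j k \<Longrightarrow> (a+i) + (b+j) + (c+k) = a + b + c + 4"
  using moveD(7)[of i j k] by simp

lemma drift_bounds:
  fixes t :: real
  assumes "3 \<le> t"
  shows "1 / t\<^sup>2 \<le> 1/t - 1/(t+4)"
    and "0 \<le> (30*t+64)/(t+4)^3" "(30*t+64)/(t+4)^3 \<le> 8 * (1/t - 1/(t+4))"
    and "(30*t+64)/(t+4)^3 \<le> 30 / t\<^sup>2"
    and "(1 - (30*t+64)/(t+4)^3) * (1 - 1/(t+4)) \<le> 1 - 1/t"
proof -
  have d: "1/t - 1/(t+4) = 4 / (t * (t+4))" using assms by (simp add: field_simps)
  have "t * (t+4) \<le> 4 * t\<^sup>2" using assms by (simp add: power2_eq_square)
  then have "4 / (4 * t\<^sup>2) \<le> 4 / (t * (t+4))" using assms by (intro divide_left_mono) auto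
  then have "1 / t\<^sup>2 \<le> 4 / (t * (t+4))" by simp
  then show "1 / t\<^sup>2 \<le> 1/t - 1/(t+4)" by (simp add: d)
  show "0 \<le> (30*t+64)/(t+4)^3" using assms by simp
  have "(30*t+64)/(t+4)^3 \<le> 30*(t+4)/(t+4)^3" using assms by (intro divide_right_mono) auto
  also have "\<dots> = 30 / (t+4)\<^sup>2" 
  proof -
    have "t + 4 \<noteq> 0" using assms by simp
    then show ?thesis unfolding power2_eq_square power3_eq_cube
      by (simp only: mult_divide_mult_cancel_right times_divide_eq_right[symmetric] mult.assoc[symmetric]) simp
  qed
  finally have e: "(30*t+64)/(t+4)^3 \<le> 30 / (t+4)\<^sup>2" .
  also have "\<dots> \<le> 30 / (t * (t+4))"
    using assms by (intro divide_left_mono) (auto simp: power2_eq_square)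
  also have "\<dots> \<le> 32 / (t * (t+4))" using assms by (intro divide_right_mono) auto
  finally show "(30*t+64)/(t+4)^3 \<le> 8 * (1/t - 1/(t+4))" by (simp add: d)
  have "30 / (t+4)\<^sup>2 \<le> 30 / t\<^sup>2"
    using assms by (intro divide_left_mono power_mono) auto
  with e show "(30*t+64)/(t+4)^3 \<le> 30 / t\<^sup>2" by linarith
  have "4 * (t+4)^3 \<le> t * (30*t+64) * (t+3)"
  proof -
    have "t * (30*t+64) * (t+3) - 4 * (t+4)^3 = 26 * t^3 + 106 * t\<^sup>2 - 256" by algebra
    moreover have "26 * 3^3 \<le> 26 * t^3" "106 * 3\<^sup>2 \<le> 106 * t\<^sup>2"
      using assms by (intro mult_left_mono power_mono; simp)+
    ultimately show ?thesis by simp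
  qed
  then have "4 / (t * (t+4)) \<le> (30*t+64)/(t+4)^3 * ((t+3)/(t+4))"
    using assms by (simp add: divide_simps) (simp add: algebra_simps power3_eq_cube)
  moreover have "1 - 1/(t+4) = (t+3)/(t+4)" using assms by (simp add: field_simps)
  ultimately show "(1 - (30*t+64)/(t+4)^3) * (1 - 1/(t+4)) \<le> 1 - 1/t"
    using d by (simp only: left_diff_distrib mult_1)
qed

text \<open>
  The distance of \<open>xyz\<close> from its maximum, plus the order of magnitude \<open>1/t\<close> of the distance that
  the later noise creates even from the centre.
\<close>
definition gap :: "real \<Rightarrow> real \<Rightarrow> real \<Rightarrow> real" where
  "gap a b c = 1/27 - level a b c + 1/(a+b+c)"

text \<open>
  Functions of the state that do not increase on average in a step; all degrees are
  at least 1 in every reachable state.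
\<close>
definition supermart :: "(real \<Rightarrow> real \<Rightarrow> real \<Rightarrow> real) \<Rightarrow> bool" where
  "supermart f \<longleftrightarrow> (\<forall>a\<ge>1. \<forall>b\<ge>1. \<forall>c\<ge>1. avg a b c (\<lambda>i j k. f (a+i) (b+j) (c+k)) \<le> f a b c)"

lemma supermartI:
  assumes "\<And>a b c. 1 \<le> a \<Longrightarrow> 1 \<le> b \<Longrightarrow> 1 \<le> c \<Longrightarrow> 
      avg a b c (\<lambda>i j k. f (a+i) (b+j) (c+k)) \<le> f a b c"
  shows "supermart f"
  using assms by (simp add: supermart_def)

lemma supermart_level: "supermart (\<lambda>a b c. level a b c * (1 - 1/(a+b+c)))"
proof (rule supermartI)
  fix a b c :: real assume abc: "1 \<le> a" "1 \<le> b" "1 \<le> c"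
  define t where "t = a + b + c"
  have t: "3 \<le> t" using abc by (simp add: t_def)
  have "avg a b c (\<lambda>i j k. level (a+i) (b+j) (c+k) * (1 - 1/((a+i)+(b+j)+(c+k))))
      = avg a b c (\<lambda>i j k. (1 - 1/(t+4)) * level (a+i) (b+j) (c+k))"
    by (rule avg_cong) (simp add: move_sum t_def)
  also have "\<dots> = level a b c * ((1 - (30*t+64)/(t+4)^3) * (1 - 1/(t+4)))"
    using abc by (simp add: avg_cmult avg_level t_def)
  also have "\<dots> \<le> level a b c * (1 - 1/t)"
    using drift_bounds(5)[OF t] level_bounds[of a b c] abc by (intro mult_left_mono) auto
  finally show "avg a b c (\<lambda>i j k. level (a+i) (b+j) (c+k) * (1 - 1/((a+i)+(b+j)+(c+k))))
      \<le> level a b c * (1 - 1/(a+b+c))" by (simp add: t_def)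
qed

lemma supermart_gap: "supermart gap"
proof (rule supermartI)
  fix a b c :: real assume abc: "1 \<le> a" "1 \<le> b" "1 \<le> c"
  define t where "t = a + b + c"
  have t: "3 \<le> t" using abc by (simp add: t_def)
  let ?d = "(30*t+64)/(t+4)^3"
  have "avg a b c (\<lambda>i j k. gap (a+i) (b+j) (c+k))
      = avg a b c (\<lambda>i j k. (1/27 + 1/(t+4)) - level (a+i) (b+j) (c+k))"
    by (rule avg_cong) (simp add: move_sum t_def gap_def)
  also have "\<dots> = (1/27 + 1/(t+4)) - level a b c * (1 - ?d)"
    using abc by (simp add: avg_diff avg_const avg_level t_def)
  also have "\<dots> \<le> gap a b c"
  proof -
    have "level a b c * ?d \<le> 1/27 * (8 * (1/t - 1/(t+4)))"
      using drift_bounds[OF t] level_bounds[of a b c] abc by (intro mult_mono) auto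
    moreover have "0 \<le> 1/t - 1/(t+4)" using drift_bounds(2,3)[OF t] by argo
    moreover have "level a b c * (1 - ?d) = level a b c - level a b c * ?d" by algebra
    ultimately show ?thesis unfolding gap_def t_def[symmetric] by argo
  qed
  finally show "avg a b c (\<lambda>i j k. gap (a+i) (b+j) (c+k)) \<le> gap a b c" .
qed

lemma gap_pos:
  assumes "1 \<le> a" "1 \<le> b" "1 \<le> c"
  shows "0 < gap a b c" "0 < 1/(a+b+c)" "1/(a+b+c) \<le> gap a b c" "gap a b c \<le> 1"
proof -
  show 1: "0 < 1/(a+b+c)" using assms by simp
  show 2: "1/(a+b+c) \<le> gap a b c" using level_bounds[of a b c] assms by (simp add: gap_def)
  show "0 < gap a b c" using 1 2 by linarith
  have "1/(a+b+c) \<le> 1/3" using assms by (intro divide_left_mono) auto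
  then show "gap a b c \<le> 1" using level_bounds(1)[of a b c] assms unfolding gap_def by linarith
qed

text \<open>
  The variance added to \<open>s\<^sup>2\<close> in one step is \<open>O(s/t\<^sup>2)\<close>, which the decrease of the correction
  term \<open>7000 s/t\<close> absorbs. This is where the sharper bound of \<open>level_step\<close> is needed.
\<close>
lemma supermart_gap_square: "supermart (\<lambda>a b c. (gap a b c)\<^sup>2 + 7000 * gap a b c / (a+b+c))"
proof (rule supermartI)
  fix a b c :: real assume abc: "1 \<le> a" "1 \<le> b" "1 \<le> c"
  define t where "t = a + b + c"
  define s where "s = gap a b c"
  have t: "3 \<le> t" using abc by (simp add: t_def)
  have s: "0 < s" "1/t \<le> s" "1/27 - level a b c \<le> s"
    using gap_pos[OF abc] by (auto simp: s_def t_def gap_def)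
  have sq: "(gap (a+i) (b+j) (c+k) - s)\<^sup>2 \<le> 6976 * s / t\<^sup>2" if ijk: "move i j k" for i j k
  proof -
    define u v where "u = level a b c - level (a+i) (b+j) (c+k)" and "v = 1/(t+4) - 1/t"
    have e: "gap (a+i) (b+j) (c+k) - s = u + v"
      by (simp add: s_def gap_def move_sum[OF ijk] u_def v_def t_def)
    have "(u+v)\<^sup>2 \<le> 2 * u\<^sup>2 + 2 * v\<^sup>2"
      using sum_squares_bound[of u v] by (simp add: power2_sum)
    moreover have "u\<^sup>2 \<le> 3456 * (1/27 - level a b c) / t\<^sup>2 + 2048 / t^4"
      using level_step(2)[OF _ _ _ ijk, of a b c] abc by (simp add: u_def t_def power2_commute)
    moreover have "v\<^sup>2 \<le> 16 / t^4"
    proof -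
      have "v = - (4 / (t * (t+4)))" using t by (simp add: v_def field_simps)
      moreover have "4 / (t * (t+4)) \<le> 4 / t\<^sup>2"
        using t by (intro divide_left_mono) (auto simp: power2_eq_square)
      moreover have "0 \<le> 4 / (t * (t+4))" using t by simp
      ultimately have "\<bar>v\<bar> \<le> 4 / t\<^sup>2" by linarith
      then have "v\<^sup>2 \<le> (4 / t\<^sup>2)\<^sup>2" using abs_le_square_iff[of v "4/t\<^sup>2"] by simp
      then show ?thesis by (simp add: power_divide flip: power_mult)
    qed
    moreover have "6912 * (1/27 - level a b c) / t\<^sup>2 + 4128 / t^4 \<le> 6976 * s / t\<^sup>2"
    proof -
      have "4128 / t^4 \<le> 6912 * (1/t) / t\<^sup>2"
      proof -
        have "4128 / t^4 = (4128 / t) * (1/t) / t\<^sup>2" by (simp add: power4_eq_xxxx power2_eq_square)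
        also have "\<dots> \<le> 6912 * (1/t) / t\<^sup>2"
          using t by (intro divide_right_mono mult_right_mono) (auto simp: field_simps)
        finally show ?thesis .
      qed
      moreover have "6912 * (1/27 - level a b c) / t\<^sup>2 + 6912 * (1/t) / t\<^sup>2 = 6912 * s / t\<^sup>2"
        unfolding add_divide_distrib[symmetric] by (simp add: s_def gap_def t_def)
      moreover have "6912 * s / t\<^sup>2 \<le> 6976 * s / t\<^sup>2"
        using s by (intro divide_right_mono) auto
      ultimately show ?thesis by argo
    qed
    ultimately show ?thesis unfolding e by argo
  qed
  have "avg a b c (\<lambda>i j k. (gap (a+i) (b+j) (c+k))\<^sup>2 + 7000 * gap (a+i) (b+j) (c+k) / ((a+i)+(b+j)+(c+k)))
    \<le> avg a b c (\<lambda>i j k. (6976 * s / t\<^sup>2 - s\<^sup>2) + (2 * s + 7000/(t+4)) * gap (a+i) (b+j) (c+k))"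
  proof (rule avg_mono)
    fix i j k assume ijk: "move i j k"
    define g where "g = gap (a+i) (b+j) (c+k)"
    have "g\<^sup>2 = (g - s)\<^sup>2 - s\<^sup>2 + 2 * s * g" by (simp add: power2_eq_square algebra_simps)
    then show "(gap (a+i) (b+j) (c+k))\<^sup>2 + 7000 * gap (a+i) (b+j) (c+k) / ((a+i)+(b+j)+(c+k))
      \<le> (6976 * s / t\<^sup>2 - s\<^sup>2) + (2 * s + 7000/(t+4)) * gap (a+i) (b+j) (c+k)"
      using sq[OF ijk] unfolding g_def[symmetric] move_sum[OF ijk] t_def[symmetric]
      by (simp add: algebra_simps)
  qed (use abc in auto)
  also have "\<dots> = (6976 * s / t\<^sup>2 - s\<^sup>2) + (2 * s + 7000/(t+4)) * avg a b c (\<lambda>i j k. gap (a+i) (b+j) (c+k))"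
    using abc by (simp add: avg_add avg_cmult avg_const)
  also have "\<dots> \<le> (6976 * s / t\<^sup>2 - s\<^sup>2) + (2 * s + 7000/(t+4)) * s"
    using supermart_gap abc s t unfolding supermart_def s_def
    by (intro add_left_mono mult_left_mono) auto
  also have "\<dots> \<le> s\<^sup>2 + 7000 * s / t"
  proof -
    have "7000 * s * (1/t\<^sup>2) \<le> 7000 * s * (1/t - 1/(t+4))"
      using drift_bounds(1)[OF t] s by (intro mult_left_mono) auto
    moreover have "6976 * s / t\<^sup>2 \<le> 7000 * s / t\<^sup>2"
      using s t by (intro divide_right_mono) auto
    ultimately show ?thesis by (simp add: algebra_simps power2_eq_square)
  qed
  finally show "avg a b c (\<lambda>i j k. (gap (a+i) (b+j) (c+k))\<^sup>2 + 7000 * gap (a+i) (b+j) (c+k) / ((a+i)+(b+j)+(c+k)))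
    \<le> (gap a b c)\<^sup>2 + 7000 * gap a b c / (a+b+c)" by (simp add: s_def t_def)
qed

lemma supermart_level_square:
  assumes "0 \<le> \<mu>" "\<mu> \<le> 1"
  shows "supermart (\<lambda>a b c. (level a b c - \<mu>)\<^sup>2 + 200 / (a+b+c))"
proof (rule supermartI)
  fix a b c :: real assume abc: "1 \<le> a" "1 \<le> b" "1 \<le> c"
  define t where "t = a + b + c"
  define m where "m = level a b c"
  have t: "3 \<le> t" using abc by (simp add: t_def)
  have m: "0 \<le> m" "m \<le> 1/27" using level_bounds[of a b c] abc by (auto simp: m_def)
  let ?d = "(30*t+64)/(t+4)^3"
  have "avg a b c (\<lambda>i j k. (level (a+i) (b+j) (c+k) - \<mu>)\<^sup>2 + 200 / ((a+i)+(b+j)+(c+k)))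
    \<le> avg a b c (\<lambda>i j k. ((m-\<mu>)\<^sup>2 - 2*(m-\<mu>)*m + 144/t\<^sup>2 + 200/(t+4)) + (2*(m-\<mu>)) * level (a+i) (b+j) (c+k))"
  proof (rule avg_mono)
    fix i j k assume ijk: "move i j k"
    define g where "g = level (a+i) (b+j) (c+k)"
    have "\<bar>g - m\<bar> \<le> 12 / t"
      using level_step(1)[OF _ _ _ ijk, of a b c] abc by (simp add: g_def m_def t_def)
    then have "(g - m)\<^sup>2 \<le> (12/t)\<^sup>2" using abs_le_square_iff[of "g-m" "12/t"] t by simp
    then have "(g - m)\<^sup>2 \<le> 144/t\<^sup>2" by (simp add: power_divide)
    moreover have "(g-\<mu>)\<^sup>2 = (g-m)\<^sup>2 + (m-\<mu>)\<^sup>2 - 2*(m-\<mu>)*m + 2*(m-\<mu>)*g"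
      by (simp add: power2_eq_square algebra_simps)
    ultimately show "(level (a+i) (b+j) (c+k) - \<mu>)\<^sup>2 + 200 / ((a+i)+(b+j)+(c+k))
      \<le> ((m-\<mu>)\<^sup>2 - 2*(m-\<mu>)*m + 144/t\<^sup>2 + 200/(t+4)) + (2*(m-\<mu>)) * level (a+i) (b+j) (c+k)"
      unfolding g_def[symmetric] move_sum[OF ijk] t_def[symmetric] by linarith
  qed (use abc in auto)
  also have "\<dots> = ((m-\<mu>)\<^sup>2 - 2*(m-\<mu>)*m + 144/t\<^sup>2 + 200/(t+4)) + (2*(m-\<mu>)) * (m * (1 - ?d))"
    using abc by (simp add: avg_add avg_cmult avg_const avg_level m_def t_def)
  also have "\<dots> = (m-\<mu>)\<^sup>2 + 144/t\<^sup>2 + 200/(t+4) + 2*((\<mu>-m)*(m*?d))"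
    by algebra
  also have "(\<mu>-m)*(m*?d) \<le> 1 * (1/27 * (30/t\<^sup>2))"
  proof -
    have 1: "0 \<le> m * ?d" "m * ?d \<le> 1/27 * (30/t\<^sup>2)"
      using m drift_bounds[OF t] by (intro mult_nonneg_nonneg mult_mono; simp)+
    have "(\<mu>-m)*(m*?d) \<le> 1 * (m * ?d)" using assms m 1 by (intro mult_right_mono) auto
    with 1 show ?thesis by linarith
  qed
  also have "(m-\<mu>)\<^sup>2 + 144/t\<^sup>2 + 200/(t+4) + 2 * (1 * (1/27 * (30/t\<^sup>2))) \<le> (m-\<mu>)\<^sup>2 + 200/t"
  proof -
    define u where "u = 1/t\<^sup>2"
    have "144/t\<^sup>2 = 144 * u" "30/t\<^sup>2 = 30 * u" "0 \<le> u" by (simp_all add: u_def)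
    moreover have "200 * u \<le> 200/t - 200/(t+4)" using drift_bounds(1)[OF t] unfolding u_def by argo
    ultimately show ?thesis by linarith
  qed
  finally show "avg a b c (\<lambda>i j k. (level (a+i) (b+j) (c+k) - \<mu>)\<^sup>2 + 200 / ((a+i)+(b+j)+(c+k)))
    \<le> (level a b c - \<mu>)\<^sup>2 + 200 / (a+b+c)" by (simp add: m_def t_def)
qed

text \<open>
  The second-order loss in \<open>ln\<close> is paid for by the decrease of \<open>4/a\<close>; this holds for every
  increment, not only on average, so that no growth estimate for \<open>a\<close> is needed.
\<close>
lemma ln_step:
  assumes "1 \<le> a" "0 \<le> i" "i \<le> (4::real)"
  shows "4/(a+i) - ln (a+i) \<le> (4/a - ln a) - i/a"
proof -
  have "ln (a/(a+i)) \<le> a/(a+i) - 1" using assms by (intro ln_le_minus_one) auto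
  moreover have "ln (a/(a+i)) = ln a - ln (a+i)" using assms by (simp add: ln_div)
  moreover have "a/(a+i) - 1 + i/a = i*i/(a*(a+i))" using assms by (simp add: field_simps)
  moreover have "i*i/(a*(a+i)) \<le> 4*i/(a*(a+i))"
    using assms by (intro divide_right_mono mult_right_mono) auto
  moreover have "4*i/(a*(a+i)) = 4/a - 4/(a+i)" using assms by (simp add: field_simps)
  ultimately show ?thesis by linarith
qed

lemma supermart_ln_level:
  "supermart (\<lambda>a b c. 4/a + 4/b + 4/c - ln (level a b c))"
proof (rule supermartI)
  fix a b c :: real assume abc: "1 \<le> a" "1 \<le> b" "1 \<le> c"
  define t where "t = a + b + c"
  have t: "3 \<le> t" using abc by (simp add: t_def)
  have lm: "ln (level a b c) = ln a + ln b + ln c - 3 * ln (a+b+c)"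
    if "1 \<le> a" "1 \<le> b" "1 \<le> c" for a b c
    using that by (simp add: level_def ln_div ln_mult ln_realpow)
  let ?f = "\<lambda>a b c. 4/a + 4/b + 4/c - ln (level a b c)"
  have "avg a b c (\<lambda>i j k. ?f (a+i) (b+j) (c+k))
    \<le> avg a b c (\<lambda>i j k. (?f a b c + 12/t) - ((1/a) * i + ((1/b) * j + (1/c) * k)))"
  proof (rule avg_mono)
    fix i j k assume ijk: "move i j k"
    note mv = moveD[OF ijk]
    have "ln ((t+4)/t) \<le> (t+4)/t - 1" using t by (intro ln_le_minus_one) auto
    then have "ln (t+4) - ln t \<le> 4/t" using t by (simp add: ln_div field_simps)
    then have "3 * ln (a+i+(b+j)+(c+k)) \<le> 3 * ln (a+b+c) + 12/t"
      unfolding move_sum[OF ijk] t_def by simp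
    then show "?f (a+i) (b+j) (c+k) \<le> (?f a b c + 12/t) - ((1/a) * i + ((1/b) * j + (1/c) * k))"
      using ln_step[of a i] ln_step[of b j] ln_step[of c k] mv abc lm[of a b c] lm[of "a+i" "b+j" "c+k"]
      by simp
  qed (use abc in auto)
  also have "\<dots> = ?f a b c + 12/t - ((1/a) * (2 * a * (2*a+b+3*c) / t\<^sup>2)
     + ((1/b) * (2 * b * (2*b+c+3*a) / t\<^sup>2) + (1/c) * (2 * c * (2*c+a+3*b) / t\<^sup>2)))"
    using abc by (simp only: avg_diff avg_add avg_cmult) (simp add: avg_const avg_i avg_j avg_k t_def)
  also have "(1/a) * (2 * a * (2*a+b+3*c) / t\<^sup>2)
     + ((1/b) * (2 * b * (2*b+c+3*a) / t\<^sup>2) + (1/c) * (2 * c * (2*c+a+3*b) / t\<^sup>2)) = 12 * t / t\<^sup>2"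
    using abc by (simp add: t_def add_divide_distrib[symmetric])
  also have "\<dots> = 12/t" using t by (simp add: power2_eq_square)
  finally show "avg a b c (\<lambda>i j k. ?f (a+i) (b+j) (c+k)) \<le> ?f a b c" by simp
qed

section \<open>Limit sets of perturbed rotations\<close>

lemma Arg_ge_half_Im:
  assumes "0 \<le> Im u" "norm u \<le> 1/2"
  shows "Im u / 2 \<le> Arg (1 + u)"
proof -
  define z where "z = 1 + u"
  have n: "norm z \<le> 2" using norm_triangle_ineq[of 1 u] assms by (simp add: z_def)
  have re: "0 < Re z" using abs_Re_le_cmod[of u] assms by (simp add: z_def)
  then have "z \<noteq> 0" by auto
  then have npos: "0 < norm z" by simp
  have "0 \<le> Arg z" using assms by (simp add: z_def Arg_less_0)
  then have "sin (Arg z) \<le> Arg z" by (rule sin_x_le_x)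
  moreover have "sin (Arg z) = Im z / norm z" using \<open>z \<noteq> 0\<close> by (metis sin_Arg)
  moreover have "Im u / 2 \<le> Im z / norm z"
    using divide_left_mono[OF n, of "Im u"] npos assms by (simp add: z_def)
  ultimately have "Im u / 2 \<le> Arg z" by linarith
  then show ?thesis by (simp add: z_def)
qed

lemma not_summable_inverse_linear:
  fixes a :: real
  assumes "0 < a" "0 < b"
  shows "\<not> summable (\<lambda>n. 1 / (a + b * real n))"
proof
  assume s: "summable (\<lambda>n. 1 / (a + b * real n))"
  have "summable (\<lambda>n. inverse (real (Suc n)))"
  proof (rule summable_comparison_test'[OF summable_mult[OF s, of "a + b"]])
    fix n :: nat
    have "a + b * real n \<le> (a + b) * real (Suc n)" using assms by (simp add: algebra_simps)
    then have "1 / ((a + b) * real (Suc n)) \<le> 1 / (a + b * real n)"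
      using assms by (intro divide_left_mono mult_pos_pos) (auto intro: add_pos_nonneg)
    then show "norm (inverse (real (Suc n))) \<le> (a+b) * (1 / (a + b * real n))"
    proof -
      have "inverse (real (Suc n)) = (a+b) * (1 / ((a + b) * real (Suc n)))"
        using assms by (simp del: of_nat_Suc add: divide_inverse)
      also have "\<dots> \<le> (a+b) * (1 / (a + b * real n))"
        using \<open>1 / ((a + b) * real (Suc n)) \<le> _\<close> assms by (intro mult_left_mono) auto
      finally show ?thesis by simp
    qed
  qed
  then show False using not_summable_harmonic[where 'a=real] summable_Suc_iff[of "\<lambda>n. inverse (real n)"] by simp
qed

text \<open>
  A bounded planar sequence whose steps, of order \<open>1/n\<close>, have a rescaled angular momentum about the
  origin that is eventually bounded below comes close to every direction infinitely often.
\<close>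
lemma rotating_sequence_directions:
  fixes q F :: "nat \<Rightarrow> complex"
  assumes step: "\<And>n. q (Suc n) = q n + F n / of_real (a + 4 * real n)"
    and a: "0 < a" and F: "\<And>n. norm (F n) \<le> C" and B: "\<And>n. norm (q n) \<le> B"
    and c: "0 < c" and rot: "eventually (\<lambda>n. c \<le> Im (cnj (q n) * F n)) sequentially"
    and v: "norm v = 1" and e: "0 < e"
  shows "\<exists>n\<ge>N. norm (sgn (q n) - v) < e"
proof -
  define \<tau> where "\<tau> n = a + 4 * real n" for n
  have \<tau>: "0 < \<tau> n" for n using a by (simp add: \<tau>_def add_pos_nonneg)
  define u where "u n = F n / (q n * of_real (\<tau> n))" for n
  have C: "0 < C" and qC: "c \<le> norm (q n) * C" if "c \<le> Im (cnj (q n) * F n)" for n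
  proof -
    have "c \<le> norm (q n) * norm (F n)"
      using that abs_Im_le_cmod[of "cnj (q n) * F n"] by (simp add: norm_mult)
    also have "\<dots> \<le> norm (q n) * C" using F by (intro mult_left_mono) auto
    finally show 1: "c \<le> norm (q n) * C" .
    then show "0 < C" using c by (smt (verit) mult_nonneg_nonpos norm_ge_zero)
  qed
  obtain N1 where N1: "\<And>n. n \<ge> N1 \<Longrightarrow> c \<le> Im (cnj (q n) * F n)"
    using rot by (auto simp: eventually_sequentially)
  have "C > 0" using C N1 by blast
  have nu: "norm (u n) \<le> C\<^sup>2 / c / \<tau> n" if "n \<ge> N1" for n
  proof -
    have "c / C \<le> norm (q n)" using qC[OF N1[OF that]] \<open>C > 0\<close> by (simp add: field_simps)
    then have "norm (F n) / (norm (q n) * \<tau> n) \<le> C / (c / C * \<tau> n)"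
      using F[of n] c \<open>C > 0\<close> \<tau>[of n] by (intro frac_le mult_right_mono mult_pos_pos) auto
    then show ?thesis using \<tau>[of n] by (simp add: u_def norm_divide norm_mult power2_eq_square)
  qed
  have "filterlim \<tau> at_top sequentially" unfolding \<tau>_def by real_asymp
  then have "(\<lambda>n. C\<^sup>2 / c / \<tau> n) \<longlonglongrightarrow> 0" by (intro tendsto_divide_0[OF tendsto_const] filterlim_at_top_imp_at_infinity)
  then have u0: "u \<longlonglongrightarrow> 0"
    by (rule Lim_null_comparison[rotated]) (use nu in \<open>auto simp: eventually_sequentially\<close>)
  then have "eventually (\<lambda>n. norm (u n) < 1/2) sequentially"
    using order_tendstoD(2)[OF tendsto_norm, of u 0 sequentially "1/2"] by simp
  then obtain N2 where N2: "\<And>n. n \<ge> N2 \<Longrightarrow> norm (u n) < 1/2"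
    by (auto simp: eventually_sequentially)
  define \<delta> where "\<delta> n = Arg (1 + u n)" for n
  have "isCont Arg (1 + 0)" by (intro continuous_at_Arg) auto
  then have "\<delta> \<longlonglongrightarrow> Arg (1 + 0)"
    unfolding \<delta>_def using u0 by (intro isCont_tendsto_compose[where g=Arg] tendsto_add tendsto_const) auto
  then have \<delta>0: "\<delta> \<longlonglongrightarrow> 0" by simp
  obtain N3 where N3: "\<And>n. n \<ge> N3 \<Longrightarrow> \<bar>\<delta> n\<bar> < e"
    using LIMSEQ_D[OF \<delta>0 e] by auto
  define M where "M = Max {N, N1, N2, N3}"
  have M: "M \<ge> N" "M \<ge> N1" "M \<ge> N2" "M \<ge> N3" by (auto simp: M_def)
  have q0: "q n \<noteq> 0" if "n \<ge> M" for n
    using qC[OF N1, of n] that M c by auto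
  have "B > 0" using B[of M] q0[of M] by (metis less_le_trans order_refl zero_less_norm_iff)
  have \<delta>pos: "c / (2 * B\<^sup>2) * (1 / \<tau> n) \<le> \<delta> n" if "n \<ge> M" for n
  proof -
    have "u n = (cnj (q n) * F n) / of_real ((norm (q n))\<^sup>2 * \<tau> n)"
      using q0[OF that] \<tau>[of n] unfolding u_def
      by (simp only: of_real_mult complex_norm_square) (simp add: divide_simps)
    then have "Im (u n) = Im (cnj (q n) * F n) / ((norm (q n))\<^sup>2 * \<tau> n)"
      by (simp only: Im_divide_of_real)
    also have "\<dots> \<ge> c / (B\<^sup>2 * \<tau> n)"
      using N1[of n] that M c \<tau>[of n] q0[OF that] B[of n]
      by (intro frac_le mult_right_mono power_mono mult_pos_pos) auto
    finally have 1: "c / (B\<^sup>2 * \<tau> n) \<le> Im (u n)" .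
    moreover have "0 < c / (B\<^sup>2 * \<tau> n)" using c \<open>B > 0\<close> \<tau>[of n] by simp
    moreover have "Im (u n) / 2 \<le> \<delta> n" unfolding \<delta>_def
      using N2[of n] that M calculation by (intro Arg_ge_half_Im) auto
    ultimately show ?thesis by simp
  qed
  have \<delta>nn: "0 < \<delta> n" if "n \<ge> M" for n
    using \<delta>pos[OF that] c \<open>B > 0\<close> \<tau>[of n] by (smt (verit) divide_pos_pos mult_pos_pos zero_less_power)
  \<comment> \<open>The angle turned since time \<open>M\<close>, not reduced modulo \<open>2 \<pi>\<close>.\<close>
  define \<theta> where "\<theta> n = (\<Sum>k<n. \<delta> (M + k))" for n
  have sgnq: "sgn (q (M + n)) = sgn (q M) * cis (\<theta> n)" for n
  proof (induction n)
    case (Suc n)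
    have ne: "q (M+n) \<noteq> 0" "q (M + Suc n) \<noteq> 0" by (auto intro!: q0)
    have "q (M + Suc n) = q (M + n) * (1 + u (M + n))"
      using ne step[of "M+n", folded \<tau>_def] \<tau>[of "M+n"] by (simp add: u_def distrib_left)
    then have "sgn (q (M + Suc n)) = sgn (q (M + n)) * sgn (1 + u (M + n))"
      by (simp add: sgn_mult)
    moreover have "sgn (1 + u (M + n)) = cis (\<delta> (M + n))"
      using \<open>q (M + Suc n) = _\<close> ne unfolding \<delta>_def by (subst cis_Arg) auto
    ultimately show ?case using Suc by (simp add: \<theta>_def cis_mult[symmetric] mult.assoc)
  qed (simp add: \<theta>_def)
  have \<theta>_unbounded: "\<exists>n. L < \<theta> n" for L
  proof (rule ccontr)
    assume "\<not> (\<exists>n. L < \<theta> n)"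
    then have "\<theta> n \<le> L" for n by (auto simp: not_less)
    then have "summable (\<lambda>k. \<delta> (M + k))"
      using \<delta>nn by (intro summableI_nonneg_bounded[where x=L]) (auto simp: \<theta>_def less_imp_le)
    then have "summable (\<lambda>k. c / (2 * B\<^sup>2) * (1 / \<tau> (M + k)))"
      by (rule summable_comparison_test'[where N=0])
         (use \<delta>pos c \<open>B > 0\<close> \<tau> in \<open>auto simp: abs_mult less_imp_le\<close>)
    then have "summable (\<lambda>k. 2 * B\<^sup>2 / c * (c / (2 * B\<^sup>2) * (1 / \<tau> (M + k))))"
      by (rule summable_mult)
    then have "summable (\<lambda>k. 1 / \<tau> (M + k))" using c \<open>B > 0\<close> by simp
    moreover have "\<tau> (M + k) = \<tau> M + 4 * real k" for k by (simp add: \<tau>_def)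
    ultimately show False using not_summable_inverse_linear[of "\<tau> M" 4] \<tau>[of M] by simp
  qed
  define \<phi> where "\<phi> = Arg (v / sgn (q M))"
  have qM: "sgn (q M) \<noteq> 0" "norm (sgn (q M)) = 1" using q0[of M] by (auto simp: norm_sgn sgn_zero_iff)
  have v0: "v \<noteq> 0" using v by auto
  have "norm (v / sgn (q M)) = 1" using v qM(2) by (simp only: norm_divide)
  then have "sgn (v / sgn (q M)) = v / sgn (q M)"
    by (simp only: sgn_eq[of "v / sgn (q M)"] of_real_1 div_by_1)
  then have \<phi>: "sgn (q M) * cis \<phi> = v" using v0 qM by (simp add: \<phi>_def cis_Arg)
  obtain j :: nat where j: "0 < \<phi> + 2 * pi * real j"
  proof -
    have "0 < \<phi> + 2 * pi * 1" using Arg_bounded[of "v / sgn (q M)"] pi_gt_zero unfolding \<phi>_def by linarith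
    then show ?thesis using that[of 1] by simp
  qed
  define L where "L = \<phi> + 2 * pi * real j"
  have cisL: "cis L = cis \<phi>"
    by (simp add: L_def cis_mult[symmetric] mult.commute[of "2*pi"])
      (metis cis_2pi cis_multiple_2pi mult.commute of_nat_in_Nats Ints_of_nat mult.right_neutral)
  \<comment> \<open>At the first passage over \<open>L\<close> the overshoot is at most the last increment.\<close>
  define n where "n = (LEAST n. L < \<theta> n)"
  have n1: "L < \<theta> n" unfolding n_def using \<theta>_unbounded by (rule LeastI_ex)
  then have "n \<noteq> 0" using j by (intro notI) (simp add: L_def \<theta>_def)
  then obtain k where k: "n = Suc k" using not0_implies_Suc by blast
  have "\<theta> k \<le> L" using not_less_Least[of k "\<lambda>n. L < \<theta> n"] k by (simp add: n_def[symmetric] not_less)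
  moreover have "\<theta> n = \<theta> k + \<delta> (M + k)" by (simp add: k \<theta>_def)
  ultimately have "\<bar>\<theta> n - L\<bar> < e" using n1 N3[of "M+k"] M by auto
  moreover have "norm (sgn (q (M+n)) - v) \<le> \<bar>\<theta> n - L\<bar>"
  proof -
    have "sgn (q (M+n)) - v = sgn (q M) * (cis (\<theta> n) - cis L)"
      unfolding sgnq cisL \<phi>[symmetric] by (simp add: algebra_simps)
    then have "norm (sgn (q (M+n)) - v) = norm (cis (\<theta> n) - cis L)" using qM by (simp add: norm_mult)
    also have "cis (\<theta> n) - cis L = cis L * (cis (\<theta> n - L) - 1)"
      by (simp add: right_diff_distrib cis_mult)
    also have "norm \<dots> \<le> \<bar>\<theta> n - L\<bar>"
      using iexp_approx1[of "\<theta> n - L" 0] by (simp add: norm_mult cis_conv_exp)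
    finally show ?thesis .
  qed
  ultimately show ?thesis using M by (intro exI[of _ "M+n"]) auto
qed


text \<open>
  Up to a factor, the right-hand side is the angular momentum of the drift about the centre.
\<close>
lemma rotation_lower_bound:
  fixes x y z :: real
  assumes "x + y + z = 1" "0 \<le> x" "0 \<le> y" "0 \<le> z"
  shows "x*y*z * (1/27 - x*y*z) \<le> x * (y-z)\<^sup>2 + y * (z-x)\<^sup>2 + z * (x-y)\<^sup>2"
proof -
  let ?S = "(x-y)\<^sup>2 + (y-z)\<^sup>2 + (z-x)\<^sup>2" and ?W = "x * (y-z)\<^sup>2 + y * (z-x)\<^sup>2 + z * (x-y)\<^sup>2"
  have le1: "x \<le> 1" "y \<le> 1" "z \<le> 1" using assms by auto
  have "?W \<le> 1 * (y-z)\<^sup>2 + 1 * (z-x)\<^sup>2 + 1 * (x-y)\<^sup>2"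
    using le1 by (intro add_mono mult_right_mono) auto
  moreover have "0 \<le> ?S" by simp
  ultimately have "1/27 - x*y*z \<le> ?S"
    unfolding gap_identity[OF assms(1)] by argo
  then have "x*y*z * (1/27 - x*y*z) \<le> x*y*z * ?S"
    using assms by (intro mult_left_mono) auto
  also have "\<dots> = x*y*z * (y-z)\<^sup>2 + x*y*z * (z-x)\<^sup>2 + x*y*z * (x-y)\<^sup>2" by algebra
  also have "\<dots> \<le> ?W"
  proof (intro add_mono mult_right_mono)
    show "x*y*z \<le> x" using assms le1 by (simp add: mult.assoc mult_left_le mult_le_one)
    show "x*y*z \<le> y" using mult_left_le[of "x*z" y] assms le1 by (simp add: mult_le_one mult_ac)
    show "x*y*z \<le> z" using mult_left_le[of "x*y" z] assms le1 by (simp add: mult_le_one mult_ac)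
  qed auto
  finally show ?thesis .
qed

text \<open>
  Along a ray from the centre \<open>ln (xyz)\<close> is concave with its maximum at the centre, so
  no value below the maximum is taken twice.
\<close>
lemma ray_injective:
  fixes x y z x' y' z' :: real
  assumes s: "x + y + z = 1" "x' + y' + z' = 1" and pos: "0 < x" "0 < y" "0 < z" "0 < x'" "0 < y'" "0 < z'"
    and m: "x*y*z = x'*y'*z'" and t: "0 < t" "t \<le> 1"
    and ray: "x - 1/3 = t * (x' - 1/3)" "y - 1/3 = t * (y' - 1/3)" and lt: "x'*y'*z' < 1/27"
  shows "x = x' \<and> y = y' \<and> z = z'"
proof -
  have ln_ge: "t * ln u + (1-t) * ln (1/3) \<le> ln w" if "w - 1/3 = t * (u - 1/3)" "0 < u" for u w :: real
  proof -
    have "w = (1-t) * (1/3) + t * u" using that(1) by algebra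
    then show ?thesis
      using concave_onD[OF ln_concave, of t "1/3" u] that t by simp
  qed
  have z: "z - 1/3 = t * (z' - 1/3)"
  proof -
    have "z - 1/3 = -(x - 1/3) - (y - 1/3)" "z' - 1/3 = -(x' - 1/3) - (y' - 1/3)" using s by auto
    then show ?thesis unfolding ray by algebra
  qed
  have "t * (ln x' + ln y' + ln z') + (1-t) * (3 * ln (1/3)) \<le> ln x + ln y + ln z"
    using ln_ge[OF ray(1)] ln_ge[OF ray(2)] ln_ge[OF z] pos by (simp add: algebra_simps)
  also have "\<dots> = ln (x'*y'*z')" using pos m by (simp add: ln_mult flip: m)
  also have "ln x' + ln y' + ln z' = ln (x'*y'*z')" using pos by (simp add: ln_mult)
  finally have "(1-t) * (3 * ln (1/3)) \<le> (1-t) * ln (x'*y'*z')" by (simp add: algebra_simps)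
  moreover have "ln (x'*y'*z') < ln ((1/3)^3)" using pos lt by (subst ln_less_cancel_iff) (auto simp: power3_eq_cube)
  then have "ln (x'*y'*z') < 3 * ln (1/3)" by (subst (asm) ln_realpow) auto
  ultimately have "t = 1" using t by (smt (verit) mult_less_cancel_left_pos)
  then show ?thesis using ray z by simp
qed

lemma same_direction_same_level:
  fixes x y z x' y' z' :: real
  assumes s: "x + y + z = 1" "x' + y' + z' = 1" and pos: "0 < x" "0 < y" "0 < z" "0 < x'" "0 < y'" "0 < z'"
    and m: "x*y*z = x'*y'*z'" and lt: "x'*y'*z' < 1/27"
    and dir: "sgn (Complex (x - 1/3) (y - 1/3)) = sgn (Complex (x' - 1/3) (y' - 1/3))"
  shows "x = x' \<and> y = y' \<and> z = z'"
proof -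
  define p p' where "p = Complex (x - 1/3) (y - 1/3)" and "p' = Complex (x' - 1/3) (y' - 1/3)"
  have "p \<noteq> 0"
  proof
    assume "p = 0"
    then have "x = 1/3" "y = 1/3" by (auto simp: p_def complex_eq_iff)
    moreover from this s have "z = 1/3" by simp
    ultimately have "x*y*z = 1/3*(1/3)*(1/3)" by (simp only:)
    with m lt show False by simp
  qed
  moreover have dir: "sgn p = sgn p'" using dir by (simp add: p_def p'_def)
  ultimately have p': "p' \<noteq> 0" by (metis sgn_zero_iff)
  have e: "p = of_real (norm p / norm p') * p'"
    using dir \<open>p \<noteq> 0\<close> p' by (simp add: sgn_eq field_simps)
  show ?thesis
  proof (cases "norm p \<le> norm p'")
    case True
    show ?thesis
      using e True \<open>p \<noteq> 0\<close> p' by (intro ray_injective[OF s pos m _ _ _ _ lt, of "norm p / norm p'"])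
        (auto simp: p_def p'_def complex_eq_iff)
  next
    case False
    have e': "p' = of_real (norm p' / norm p) * p" using e \<open>p \<noteq> 0\<close> p' by (simp add: field_simps)
    have "x' = x \<and> y' = y \<and> z' = z"
      using e' False \<open>p \<noteq> 0\<close> p' lt m
      by (intro ray_injective[OF s(2,1) pos(4-6) pos(1-3) m[symmetric], of "norm p' / norm p"])
        (auto simp: p_def p'_def complex_eq_iff)
    then show ?thesis by simp
  qed
qed

lemma limit_setI:
  fixes s :: "nat \<Rightarrow> 'a::topological_space"
  assumes "strict_mono r" "(s \<circ> r) \<longlonglongrightarrow> l"
  shows "l \<in> limit_set s"
  using assms by (auto simp: limit_set_def)

lemma frequently_near_imp_subseq:
  fixes f :: "nat \<Rightarrow> 'a::metric_space"
  assumes "\<And>e N. 0 < e \<Longrightarrow> \<exists>n\<ge>N. dist (f n) l < e"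
  obtains r where "strict_mono r" "(f \<circ> r) \<longlonglongrightarrow> l"
proof -
  have "\<forall>k N. \<exists>n>N. dist (f n) l < inverse (real (Suc k))"
    using assms[of "inverse (real (Suc _))" "Suc _"] by (auto simp: Suc_le_eq)
  then obtain g where g: "\<And>k N. g k N > N" "\<And>k N. dist (f (g k N)) l < inverse (real (Suc k))" by metis
  define r where "r = rec_nat 0 (\<lambda>k N. g k N)"
  have r: "r (Suc k) = g k (r k)" for k by (simp add: r_def)
  have "strict_mono r" using g(1) by (simp add: strict_mono_Suc_iff r)
  moreover have "(\<lambda>k. f (r (Suc k))) \<longlonglongrightarrow> l"
    unfolding tendsto_dist_iff[of _ l] using g(2)
    by (intro Lim_null_comparison[OF _ LIMSEQ_inverse_real_of_nat]) (auto simp: r less_imp_le)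
  then have "(f \<circ> r) \<longlonglongrightarrow> l" unfolding comp_def by (rule LIMSEQ_imp_Suc)
  ultimately show ?thesis by (rule that)
qed

lemma compact_simplex2: "compact simplex2"
proof -
  have "simplex2 \<subseteq> cbox (0,0,0) (1,1,1)" by (auto simp: simplex2_def)
  moreover have "closed simplex2"
  proof -
    have "closed ({p. 0 \<le> fst p} \<inter> {p. 0 \<le> fst (snd p)} \<inter> {p. 0 \<le> snd (snd p)}
        \<inter> {p::real\<times>real\<times>real. fst p + fst (snd p) + snd (snd p) = 1})"
      by (intro closed_Int closed_Collect_le closed_Collect_eq continuous_intros)
    also have "{p. 0 \<le> fst p} \<inter> {p. 0 \<le> fst (snd p)} \<inter> {p. 0 \<le> snd (snd p)}
        \<inter> {p. fst p + fst (snd p) + snd (snd p) = 1} = simplex2" by (auto simp: simplex2_def)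
    finally show ?thesis .
  qed
  ultimately show ?thesis using bounded_cbox bounded_subset compact_eq_bounded_closed by blast
qed

text \<open>
  The points of the simplex with \<open>xyz = m\<close>; for \<open>0 < m < 1/27\<close> a closed curve around the centre.
\<close>
definition level_curve :: "real \<Rightarrow> (real \<times> real \<times> real) set" where
  "level_curve m = {(x, y, z). (x, y, z) \<in> simplex2 \<and> x * y * z = m}"

lemma level_curve_pos:
  assumes "(x, y, z) \<in> level_curve m" "0 < m"
  shows "0 < x" "0 < y" "0 < z" "x + y + z = 1" "x * y * z = m"
  using assms by (auto simp: level_curve_def simplex2_def zero_less_mult_iff)

text \<open>
  Here \<open>a + 4 n\<close> is the total degree after the step, and the two summability assumptions say that
  the accumulated noise converges. The planar coordinates used are \<open>(x - 1/3, y - 1/3)\<close>; they distort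
  angles, but any linear coordinates will do.
\<close>
lemma limit_set_rotation:
  fixes x y z :: "nat \<Rightarrow> real"
  assumes a: "0 < a"
    and pos: "\<And>n. 0 \<le> x n" "\<And>n. 0 \<le> y n" "\<And>n. 0 \<le> z n" and sum1: "\<And>n. x n + y n + z n = 1"
    and nx: "summable (\<lambda>n. x (Suc n) - x n - 2 * x n * (z n - y n) / (a + 4 * real n))"
    and ny: "summable (\<lambda>n. y (Suc n) - y n - 2 * y n * (x n - z n) / (a + 4 * real n))"
    and lim: "(\<lambda>n. x n * y n * z n) \<longlonglongrightarrow> m" and m: "0 < m" "m < 1/27"
  shows "limit_set (\<lambda>n. (x n, y n, z n)) = level_curve m"
proof (intro equalityI subsetI)
  have simp2: "(x n, y n, z n) \<in> simplex2" for n using pos sum1 by (simp add: simplex2_def)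
  have lc: "(\<lambda>n. x (r n) * y (r n) * z (r n)) \<longlonglongrightarrow> m" if "strict_mono r" for r
    using LIMSEQ_subseq_LIMSEQ[OF lim that] by (simp add: comp_def)
  have in_curve: "l \<in> level_curve m"
    if "strict_mono r" "((\<lambda>n. (x n, y n, z n)) \<circ> r) \<longlonglongrightarrow> l" for r l
  proof -
    obtain l1 l2 l3 where l: "l = (l1, l2, l3)" by (cases l)
    have "l \<in> simplex2"
      using closed_sequentially[OF compact_imp_closed[OF compact_simplex2] _ that(2)] simp2 by simp
    moreover have "(\<lambda>n. x (r n)) \<longlonglongrightarrow> l1" "(\<lambda>n. y (r n)) \<longlonglongrightarrow> l2" "(\<lambda>n. z (r n)) \<longlonglongrightarrow> l3"
      using tendsto_fst[OF that(2)] tendsto_fst[OF tendsto_snd[OF that(2)]]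
        tendsto_snd[OF tendsto_snd[OF that(2)]] by (auto simp: l comp_def)
    then have "(\<lambda>n. x (r n) * y (r n) * z (r n)) \<longlonglongrightarrow> l1 * l2 * l3" by (intro tendsto_mult)
    with lc[OF that(1)] have "l1 * l2 * l3 = m" using LIMSEQ_unique by blast
    ultimately show ?thesis by (simp add: l level_curve_def)
  qed
  show "l \<in> level_curve m" if "l \<in> limit_set (\<lambda>n. (x n, y n, z n))" for l
    using that in_curve unfolding limit_set_def by blast
  fix l assume l: "l \<in> level_curve m"
  obtain l1 l2 l3 where l_eq: "l = (l1, l2, l3)" by (cases l)
  note lpos = level_curve_pos[OF l[unfolded l_eq] m(1)]
  define w F where "w n = Complex (x n - 1/3) (y n - 1/3)"
    and "F n = Complex (2 * x n * (z n - y n)) (2 * y n * (x n - z n))" for n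
  define \<tau> where "\<tau> n = a + 4 * real n" for n
  define e where "e n = w (Suc n) - w n - F n / of_real (\<tau> n)" for n
  have sume: "summable e"
    unfolding summable_complex_iff using nx ny by (simp add: e_def w_def F_def \<tau>_def Re_divide_of_real Im_divide_of_real)
  define \<epsilon> where "\<epsilon> n = (\<Sum>k. e (k + n))" for n
  have \<epsilon>0: "\<epsilon> \<longlonglongrightarrow> 0" unfolding \<epsilon>_def by (rule suminf_exist_split2[OF sume])
  have \<epsilon>Suc: "\<epsilon> n = e n + \<epsilon> (Suc n)" for n
    using suminf_split_head[of "\<lambda>k. e (k + n)"] sume by (simp add: \<epsilon>_def)
  \<comment> \<open>Adding the noise still to come removes the noise from the recursion.\<close>
  define q where "q n = w n + \<epsilon> n" for n
  have qstep: "q (Suc n) = q n + F n / of_real (a + 4 * real n)" for n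
    using \<epsilon>Suc[of n] by (simp add: q_def e_def \<tau>_def)
  have le1: "x n \<le> 1" "y n \<le> 1" "z n \<le> 1" for n using pos[of n] sum1[of n] by auto
  have nF: "norm (F n) \<le> 4" for n
  proof -
    have "\<bar>2 * u * (v - w)\<bar> \<le> 2" if "0 \<le> u" "u \<le> 1" "0 \<le> v" "v \<le> 1" "0 \<le> w" "w \<le> 1" for u v w :: real
      using that by (auto simp: abs_mult intro!: mult_le_one)
    then show ?thesis
      using cmod_le[of "F n"] pos[of n] le1[of n] by (simp add: F_def) (smt (verit))
  qed
  have nw: "norm (w n) \<le> 2" for n
    using cmod_le[of "w n"] pos[of n] le1[of n] by (simp add: w_def)
  obtain B' where B': "\<And>n. norm (\<epsilon> n) \<le> B'"
    using convergent_imp_Bseq[of \<epsilon>] \<epsilon>0 by (auto simp: convergent_def Bseq_def)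
  have nq: "norm (q n) \<le> 2 + B'" for n
    using norm_triangle_ineq[of "w n" "\<epsilon> n"] nw[of n] B'[of n] by (simp add: q_def)
  define \<kappa> where "\<kappa> = m * (1/27 - m)"
  have \<kappa>: "0 < \<kappa>" using m by (simp add: \<kappa>_def)
  have rot: "eventually (\<lambda>n. \<kappa> / 3 \<le> Im (cnj (q n) * F n)) sequentially"
  proof -
    have Imw: "2/3 * (x n * y n * z n * (1/27 - x n * y n * z n)) \<le> Im (cnj (w n) * F n)" for n
    proof -
      have zn: "z n = 1 - x n - y n" using sum1[of n] by simp
      have "Im (cnj (w n) * F n) = 2/3 * (x n * (y n - z n)\<^sup>2 + y n * (z n - x n)\<^sup>2 + z n * (x n - y n)\<^sup>2)"
        unfolding zn w_def F_def by (simp add: zn field_simps power2_eq_square)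
      then show ?thesis using rotation_lower_bound[OF sum1 pos, of n] by simp
    qed
    have "(\<lambda>n. 2/3 * (x n * y n * z n * (1/27 - x n * y n * z n)) - norm (\<epsilon> n) * 4) \<longlonglongrightarrow> 2/3 * \<kappa> - norm (0::complex) * 4"
      unfolding \<kappa>_def by (intro tendsto_intros lim \<epsilon>0)
    then have "eventually (\<lambda>n. \<kappa>/3 < 2/3 * (x n * y n * z n * (1/27 - x n * y n * z n)) - norm (\<epsilon> n) * 4) sequentially"
      by (rule order_tendstoD) (use \<kappa> in auto)
    then show ?thesis
    proof eventually_elim
      case (elim n)
      have "\<bar>Im (cnj (\<epsilon> n) * F n)\<bar> \<le> norm (\<epsilon> n) * norm (F n)"
        using abs_Im_le_cmod[of "cnj (\<epsilon> n) * F n"] by (simp add: norm_mult)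
      also have "\<dots> \<le> norm (\<epsilon> n) * 4" using nF by (intro mult_left_mono) auto
      finally have "- (norm (\<epsilon> n) * 4) \<le> Im (cnj (\<epsilon> n) * F n)" by simp
      moreover have "Im (cnj (q n) * F n) = Im (cnj (w n) * F n) + Im (cnj (\<epsilon> n) * F n)"
        by (simp add: q_def algebra_simps)
      ultimately show ?case using Imw[of n] elim by linarith
    qed
  qed
  define p where "p = Complex (l1 - 1/3) (l2 - 1/3)"
  have p0: "p \<noteq> 0"
  proof
    assume "p = 0"
    then have "l1 = 1/3" "l2 = 1/3" by (auto simp: p_def complex_eq_iff)
    with lpos m show False by simp
  qed
  have near: "\<exists>n\<ge>N. dist (sgn (q n)) (sgn p) < d" if "0 < d" for d N
    unfolding dist_norm
    by (rule rotating_sequence_directions[OF qstep a nF nq _ rot _ that]) (use \<kappa> p0 in \<open>auto simp: norm_sgn\<close>)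
  obtain r where r: "strict_mono r" "(\<lambda>n. sgn (q (r n))) \<longlonglongrightarrow> sgn p"
    using frequently_near_imp_subseq[of "\<lambda>n. sgn (q n)" "sgn p"] near by (auto simp: comp_def)
  obtain l' s where s: "strict_mono s" "((\<lambda>n. (x (r n), y (r n), z (r n))) \<circ> s) \<longlonglongrightarrow> l'"
    using compact_simplex2 simp2 unfolding compact_def by (metis (no_types, lifting))
  have rs: "strict_mono (r \<circ> s)" using r(1) s(1) by (rule strict_mono_o)
  have l'lim: "((\<lambda>n. (x n, y n, z n)) \<circ> (r \<circ> s)) \<longlonglongrightarrow> l'" using s(2) by (simp add: comp_def)
  then have l': "l' \<in> level_curve m" by (rule in_curve[OF rs])
  obtain k1 k2 k3 where k_eq: "l' = (k1, k2, k3)" by (cases l')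
  note kpos = level_curve_pos[OF l'[unfolded k_eq] m(1)]
  define p' where "p' = Complex (k1 - 1/3) (k2 - 1/3)"
  have p'0: "p' \<noteq> 0"
  proof
    assume "p' = 0"
    then have "k1 = 1/3" "k2 = 1/3" by (auto simp: p'_def complex_eq_iff)
    with kpos m show False by simp
  qed
  have "(\<lambda>n. w (r (s n))) \<longlonglongrightarrow> p'"
    using tendsto_fst[OF l'lim] tendsto_fst[OF tendsto_snd[OF l'lim]]
    unfolding w_def p'_def k_eq comp_def by (auto intro!: tendsto_Complex tendsto_diff)
  moreover have "(\<lambda>n. \<epsilon> (r (s n))) \<longlonglongrightarrow> 0"
    using LIMSEQ_subseq_LIMSEQ[OF \<epsilon>0 rs] by (simp add: comp_def)
  ultimately have "(\<lambda>n. q (r (s n))) \<longlonglongrightarrow> p'" unfolding q_def using tendsto_add by fastforce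
  then have "(\<lambda>n. sgn (q (r (s n)))) \<longlonglongrightarrow> sgn p'" using p'0 by (rule tendsto_sgn)
  moreover have "(\<lambda>n. sgn (q (r (s n)))) \<longlonglongrightarrow> sgn p"
    using LIMSEQ_subseq_LIMSEQ[OF r(2) s(1)] by (simp add: comp_def)
  ultimately have "sgn p' = sgn p" using LIMSEQ_unique by blast
  then have "k1 = l1 \<and> k2 = l2 \<and> k3 = l3"
    using lpos kpos m unfolding p_def p'_def by (intro same_direction_same_level) auto
  then have "l' = l" by (simp add: l_eq k_eq)
  then show "l \<in> limit_set (\<lambda>n. (x n, y n, z n))" using limit_setI[OF rs l'lim] by simp
qed

lemma limit_set_convergent:
  fixes s :: "nat \<Rightarrow> 'a::metric_space"
  assumes "convergent s"
  shows "\<exists>l. limit_set s = {l}"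
proof -
  obtain l where l: "s \<longlonglongrightarrow> l" using assms by (auto simp: convergent_def)
  have "limit_set s = {l}"
    using l LIMSEQ_subseq_LIMSEQ[OF l] LIMSEQ_unique
    by (auto simp: limit_set_def intro!: exI[of _ id] strict_mono_id)
  then show ?thesis ..
qed

lemma level_curve_point:
  assumes "0 < m" "m < 1/27"
  obtains x y z :: real where "0 < x" "0 < y" "0 < z" "x + y + z = 1" "x * y * z = m"
proof -
  define f :: "real \<Rightarrow> real" where "f t = t * ((1-t)/2) * ((1-t)/2)" for t
  have "\<exists>t\<ge>0. t \<le> 1/3 \<and> f t = m"
    using assms by (intro IVT') (auto simp: f_def intro!: continuous_intros)
  then obtain t where t: "0 \<le> t" "t \<le> 1/3" "f t = m" by blast
  with assms have "t \<noteq> 0" by (auto simp: f_def)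
  with t show ?thesis by (intro that[of t "(1-t)/2" "(1-t)/2"]) (auto simp: f_def field_simps)
qed

lemma level_curve_not_singleton:
  assumes "0 < m" "m < 1/27"
  shows "level_curve m \<noteq> {l}"
proof
  assume l: "level_curve m = {l}"
  obtain x y z where xyz: "0 < x" "0 < y" "0 < z" "x + y + z = 1" "x * y * z = m"
    using level_curve_point[OF assms] .
  then have "(x, y, z) \<in> level_curve m" "(y, z, x) \<in> level_curve m"
    by (auto simp: level_curve_def simplex2_def)
  then have "x = y" "y = z" using l by auto
  then have "x = 1/3" "y = 1/3" "z = 1/3" using xyz(4) by auto
  then have "x * y * z = 1/3 * (1/3) * (1/3)" by (simp only:)
  then show False using xyz(5) assms by simp
qed

section \<open>Almost sure convergence of orthogonal series\<close>

lemma summable_inverse_squares: "summable (\<lambda>n. K / (real n + 1)\<^sup>2)" for K :: real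
proof -
  have "summable (\<lambda>n. inverse ((of_nat n :: real) ^ 2))"
    by (rule inverse_power_summable) simp
  then have "summable (\<lambda>n. inverse ((of_nat (Suc n) :: real) ^ 2))"
    by (subst summable_Suc_iff)
  then have "summable (\<lambda>n. K * inverse ((of_nat (Suc n) :: real) ^ 2))"
    by (rule summable_mult)
  then show ?thesis by (simp only: of_nat_Suc add.commute[of 1] divide_inverse)
qed

text \<open>
  The blocks \<open>{k\<^sup>3..<(k+1)\<^sup>3}\<close> have length \<open>O(k\<^sup>2)\<close> and indices of order \<open>k\<^sup>3\<close>. For terms of
  size \<open>O(1/n)\<close>, the block sums then have second moment \<open>O(1/k\<^sup>4)\<close> in the orthogonal case, hence first
  moment \<open>O(1/k\<^sup>2)\<close>, and in any case the absolute sum over a block is \<open>O(1/k)\<close>.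
\<close>
lemma cube_index_bound:
  assumes "0 \<le> (K::real)" "k^3 \<le> i"
  shows "K / (real i + 1) \<le> 4 * K / (real k + 1)^3"
proof -
  have "(real k + 1)^3 \<le> 4 * (real k ^ 3 + 1)"
  proof -
    have "4 * (real k ^ 3 + 1) - (real k + 1)^3 = 3 * (real k + 1) * (real k - 1)\<^sup>2" by algebra
    moreover have "0 \<le> 3 * (real k + 1) * (real k - 1)\<^sup>2" by simp
    ultimately show ?thesis by linarith
  qed
  also have "real k ^ 3 \<le> real i" using assms(2) by (metis of_nat_le_iff of_nat_power)
  finally have "(real k + 1)^3 \<le> 4 * (real i + 1)" by simp
  then have "(4 * K) / (4 * (real i + 1)) \<le> 4 * K / (real k + 1)^3"
    using assms(1) by (intro divide_left_mono) auto
  then show ?thesis by (simp add: mult_divide_mult_cancel_left del: distrib_left_numeral)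
qed

lemma cube_block_length:
  assumes "n \<le> (Suc k)^3"
  shows "real (n - k^3) \<le> 3 * (real k + 1)^2"
proof -
  have "n - k^3 \<le> (Suc k)^3 - k^3" using assms by simp
  also have "\<dots> = 3 * k^2 + 3 * k + 1" by (simp add: power3_eq_cube power2_eq_square algebra_simps)
  also have "\<dots> \<le> 3 * (k + 1)^2" by (simp add: power2_eq_square algebra_simps)
  finally have "real (n - k^3) \<le> real (3 * (k+1)^2)" by (simp only: of_nat_le_iff)
  then show ?thesis by (simp add: add.commute)
qed

lemma summable_by_cube_blocks:
  fixes f :: "nat \<Rightarrow> real"
  assumes bd: "\<And>n. \<bar>f n\<bar> \<le> K / (real n + 1)"
    and bl: "summable (\<lambda>k. \<bar>\<Sum>i\<in>{k^3..<(Suc k)^3}. f i\<bar>)"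
  shows "summable f"
proof -
  define S where "S n = (\<Sum>i<n. f i)" for n
  have K: "0 \<le> K" using bd[of 0] by simp
  have "summable (\<lambda>k. \<Sum>i\<in>{k^3..<(Suc k)^3}. f i)"
    using bl by (rule summable_rabs_cancel)
  moreover have "(\<Sum>j<k. \<Sum>i\<in>{j^3..<(Suc j)^3}. f i) = S (k^3)" for k
  proof (induction k)
    case (Suc k)
    have "k^3 \<le> (Suc k)^3" by (intro power_mono) auto
    then show ?case using Suc sum.atLeastLessThan_concat[of 0 "k^3" "(Suc k)^3" f]
      by (simp add: S_def lessThan_atLeast0 del: power_Suc)
  qed (simp add: S_def)
  ultimately obtain L where L: "(\<lambda>k. S (k^3)) \<longlonglongrightarrow> L"
    by (auto simp: summable_iff_convergent convergent_def)
  have "\<exists>k. k^3 \<le> n \<and> n < (Suc k)^3" for n :: nat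
  proof -
    have "\<exists>k. n < (Suc k)^3"
      using self_le_power[of "Suc n" 3] by (intro exI[of _ n]) auto
    then have ex: "n < (Suc (LEAST k. n < (Suc k)^3))^3" by (rule LeastI_ex)
    let ?k = "LEAST k. n < (Suc k)^3"
    have "?k^3 \<le> n"
    proof (cases ?k)
      case (Suc j)
      then have "\<not> n < (Suc j)^3" using not_less_Least[of j "\<lambda>k. n < (Suc k)^3"] by simp
      then show ?thesis using Suc by simp
    qed simp
    with ex show ?thesis by blast
  qed
  then obtain \<kappa> where \<kappa>: "\<And>n. \<kappa> n ^ 3 \<le> n" "\<And>n. n < (Suc (\<kappa> n))^3" by metis
  have lim\<kappa>: "filterlim \<kappa> at_top sequentially"
    unfolding filterlim_at_top eventually_sequentially
  proof (intro allI exI impI)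
    fix Z n :: nat assume "Z^3 \<le> n"
    then have "Z^3 < (Suc (\<kappa> n))^3" using \<kappa>(2)[of n] by linarith
    then show "Z \<le> \<kappa> n" using power_less_imp_less_base by fastforce
  qed
  have diff: "\<bar>S n - S (\<kappa> n ^ 3)\<bar> \<le> 12 * K / (real (\<kappa> n) + 1)" for n
  proof -
    define k where "k = \<kappa> n"
    have kn: "k^3 \<le> n" "n < (Suc k)^3" using \<kappa>[of n] by (auto simp: k_def)
    have "S n - S (k^3) = (\<Sum>i\<in>{k^3..<n}. f i)"
      using sum.atLeastLessThan_concat[of 0 "k^3" n f] kn by (simp add: S_def lessThan_atLeast0)
    also have "\<bar>\<dots>\<bar> \<le> (\<Sum>i\<in>{k^3..<n}. \<bar>f i\<bar>)" by (rule sum_abs)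
    also have "\<dots> \<le> (\<Sum>i\<in>{k^3..<n}. 4 * K / (real k + 1)^3)"
      using kn by (intro sum_mono order_trans[OF bd] cube_index_bound[OF K]) auto
    also have "\<dots> = real (n - k^3) * (4 * K / (real k + 1)^3)" by simp
    also have "\<dots> \<le> (3 * (real k + 1)^2) * (4 * K / (real k + 1)^3)"
      using K kn by (intro mult_right_mono cube_block_length) auto
    also have "\<dots> = 12 * K / (real k + 1)"
      by (simp add: power2_eq_square power3_eq_cube)
    finally show ?thesis by (simp add: k_def)
  qed
  have "(\<lambda>n. 12 * K / (real (\<kappa> n) + 1)) \<longlonglongrightarrow> 0"
  proof -
    have "(\<lambda>k. 12 * K / (real k + 1)) \<longlonglongrightarrow> 0" by real_asymp
    then show ?thesis using lim\<kappa> by (rule filterlim_compose)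
  qed
  then have "(\<lambda>n. S n - S (\<kappa> n ^ 3)) \<longlonglongrightarrow> 0"
    by (rule Lim_null_comparison[rotated]) (use diff in auto)
  moreover have "(\<lambda>n. S (\<kappa> n ^ 3)) \<longlonglongrightarrow> L" using L lim\<kappa> by (rule filterlim_compose)
  ultimately have "(\<lambda>n. (S n - S (\<kappa> n ^ 3)) + S (\<kappa> n ^ 3)) \<longlonglongrightarrow> 0 + L" by (rule tendsto_add)
  then have "S \<longlonglongrightarrow> L" by simp
  then show ?thesis unfolding summable_iff_convergent convergent_def S_def by blast
qed

lemma (in prob_space) orthogonal_series_summable:
  fixes f :: "nat \<Rightarrow> 'a \<Rightarrow> real"
  assumes meas [measurable]: "\<And>n. f n \<in> borel_measurable M"
    and int: "\<And>i j. integrable M (\<lambda>x. f i x * f j x)"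
    and bd: "AE x in M. \<forall>n. \<bar>f n x\<bar> \<le> K / (real n + 1)"
    and orth: "\<And>i j. i < j \<Longrightarrow> expectation (\<lambda>x. f i x * f j x) = 0"
  shows "AE x in M. summable (\<lambda>n. f n x)"
proof -
  have K: "0 \<le> K"
  proof -
    have "AE x in M. 0 \<le> K"
      using bd by eventually_elim (metis abs_ge_zero add_0 div_by_1 of_nat_0 order_trans)
    then show ?thesis using AE_False by (cases "0 \<le> K") auto
  qed
  define I where "I k = {k^3..<(Suc k)^3}" for k :: nat
  define b where "b k x = (\<Sum>i\<in>I k. f i x)" for k x
  have [measurable]: "b k \<in> borel_measurable M" for k unfolding b_def by measurable
  have sq: "(b k x)\<^sup>2 = (\<Sum>i\<in>I k. \<Sum>j\<in>I k. f i x * f j x)" for k x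
    by (simp add: b_def power2_eq_square sum_product)
  have intb2: "integrable M (\<lambda>x. (b k x)\<^sup>2)" for k
    unfolding sq using int by (intro Bochner_Integration.integrable_sum)
  have Efij: "expectation (\<lambda>x. f i x * f j x) = (if j = i then expectation (\<lambda>x. (f i x)\<^sup>2) else 0)" for i j
    using orth[of i j] orth[of j i] by (cases i j rule: linorder_cases) (auto simp: mult.commute power2_eq_square)
  have fin: "finite (I k)" for k by (simp add: I_def)
  have Eb2: "expectation (\<lambda>x. (b k x)\<^sup>2) \<le> 48 * K\<^sup>2 / (real k + 1)^4" for k
  proof -
    have "expectation (\<lambda>x. (b k x)\<^sup>2) = (\<Sum>i\<in>I k. \<Sum>j\<in>I k. expectation (\<lambda>x. f i x * f j x))"
      unfolding sq using int by (simp add: Bochner_Integration.integral_sum Bochner_Integration.integrable_sum)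
    also have "\<dots> = (\<Sum>i\<in>I k. expectation (\<lambda>x. (f i x)\<^sup>2))"
      using fin by (simp add: Efij)
    also have "\<dots> \<le> (\<Sum>i\<in>I k. (4 * K / (real k + 1)^3)\<^sup>2)"
    proof (rule sum_mono)
      fix i assume i: "i \<in> I k"
      have "expectation (\<lambda>x. (f i x)\<^sup>2) \<le> expectation (\<lambda>x. (4 * K / (real k + 1)^3)\<^sup>2)"
      proof (rule integral_mono_AE)
        show "AE x in M. (f i x)\<^sup>2 \<le> (4 * K / (real k + 1)^3)\<^sup>2"
          using bd
        proof eventually_elim
          case (elim x)
          then have "\<bar>f i x\<bar> \<le> 4 * K / (real k + 1)^3"
            using cube_index_bound[OF K, of k i] i by (force simp: I_def intro: order_trans)
          then have "\<bar>f i x\<bar>\<^sup>2 \<le> (4 * K / (real k + 1)^3)\<^sup>2" by (intro power_mono) auto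
          then show ?case by simp
        qed
      qed (use int[of i i] in \<open>auto simp: power2_eq_square\<close>)
      then show "expectation (\<lambda>x. (f i x)\<^sup>2) \<le> (4 * K / (real k + 1)^3)\<^sup>2" by (simp add: prob_space)
    qed
    also have "\<dots> = real ((Suc k)^3 - k^3) * (16 * K\<^sup>2 / (real k + 1)^6)"
      by (simp add: I_def power_divide power_mult_distrib flip: power_mult)
    also have "\<dots> \<le> (3 * (real k + 1)^2) * (16 * K\<^sup>2 / (real k + 1)^6)"
      by (intro mult_right_mono cube_block_length) auto
    also have "\<dots> = 48 * K\<^sup>2 / (real k + 1)^4"
    proof -
      define r where "r = real k + 1"
      have r: "r \<noteq> 0" "r^6 = r^2 * r^4" by (simp_all add: r_def flip: power_add)
      have cancel: "3 * u * (16 * q / (u * v)) = 48 * q / v" if "u \<noteq> 0" for u v q :: real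
        using that by simp
      show ?thesis unfolding r_def[symmetric] r(2) by (rule cancel) (use r(1) in simp)
    qed
    finally show ?thesis .
  qed
  have intb: "integrable M (b k)" for k by (rule square_integrable_imp_integrable[OF _ intb2]) simp
  have Eb: "expectation (\<lambda>x. \<bar>b k x\<bar>) \<le> (24 * K\<^sup>2 + 1) / (real k + 1)^2" for k
  proof -
    define t where "t = (real k + 1)\<^sup>2"
    have t: "t > 0" by (simp add: t_def)
    \<comment> \<open>The weight \<open>t\<close> balances the two terms for \<open>y\<close> of the expected order \<open>1/t\<close>.\<close>
    have "\<bar>y\<bar> \<le> t/2 * y\<^sup>2 + 1/(2*t)" for y :: real
    proof -
      have "0 \<le> (t * \<bar>y\<bar> - 1)\<^sup>2 / (2*t)" using t by simp
      also have "\<dots> = t/2 * y\<^sup>2 + 1/(2*t) - \<bar>y\<bar>"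
        using t by (simp add: power2_diff power_mult_distrib diff_divide_distrib add_divide_distrib)
          (simp add: power2_eq_square)
      finally show ?thesis by simp
    qed
    then have "expectation (\<lambda>x. \<bar>b k x\<bar>) \<le> expectation (\<lambda>x. t/2 * (b k x)\<^sup>2 + 1/(2*t))"
      using intb intb2 by (intro integral_mono) auto
    also have "\<dots> = t/2 * expectation (\<lambda>x. (b k x)\<^sup>2) + 1/(2*t)"
      using intb2 by (simp add: prob_space)
    also have "\<dots> \<le> t/2 * (48 * K\<^sup>2 / (real k + 1)^4) + 1/(2*t)"
      using Eb2 t by (intro add_right_mono mult_left_mono) auto
    also have "(real k + 1)^4 = t\<^sup>2" by (simp add: t_def flip: power_mult)
    also have "t/2 * (48 * K\<^sup>2 / t\<^sup>2) + 1/(2*t) = (24 * K\<^sup>2 + 1/2) / t"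
      using t by (simp add: power2_eq_square add_divide_distrib)
    also have "\<dots> \<le> (24 * K\<^sup>2 + 1) / t" using t by (intro divide_right_mono) auto
    finally show ?thesis by (simp add: t_def)
  qed
  have sumE: "summable (\<lambda>k. expectation (\<lambda>x. \<bar>b k x\<bar>))"
  proof (rule summable_comparison_test')
    show "summable (\<lambda>k. (24 * K\<^sup>2 + 1) / (real k + 1)^2)"
      by (rule summable_inverse_squares)
    show "norm (expectation (\<lambda>x. \<bar>b k x\<bar>)) \<le> (24 * K\<^sup>2 + 1) / (real k + 1)^2" for k
      using Eb[of k] by (simp add: integral_nonneg)
  qed
  have "(\<integral>\<^sup>+x. (\<Sum>k. ennreal \<bar>b k x\<bar>) \<partial>M) = (\<Sum>k. \<integral>\<^sup>+x. ennreal \<bar>b k x\<bar> \<partial>M)"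
    by (rule nn_integral_suminf) simp
  also have "\<dots> = (\<Sum>k. ennreal (expectation (\<lambda>x. \<bar>b k x\<bar>)))"
    using intb by (intro suminf_cong nn_integral_eq_integral) auto
  also have "\<dots> = ennreal (\<Sum>k. expectation (\<lambda>x. \<bar>b k x\<bar>))"
    using sumE by (rule suminf_ennreal2[rotated]) simp
  finally have "(\<integral>\<^sup>+x. (\<Sum>k. ennreal \<bar>b k x\<bar>) \<partial>M) \<noteq> \<infinity>" by simp
  then have "AE x in M. (\<Sum>k. ennreal \<bar>b k x\<bar>) \<noteq> \<infinity>"
    by (intro nn_integral_PInf_AE) auto
  with bd show ?thesis
  proof eventually_elim
    case (elim x)
    have "summable (\<lambda>k. \<bar>b k x\<bar>)"
      using elim(2) by (intro summable_suminf_not_top) auto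
    then show ?case
      unfolding b_def I_def by (rule summable_by_cube_blocks[OF elim(1)[rule_format]])
  qed
qed

section \<open>From graphs to the urn of type degrees\<close>

text \<open>
  Graphs form a countable type, so that every function of the graphs up to time \<open>n\<close> is measurable.
\<close>
instance multiset :: (countable) countable
proof
  have "inj (\<lambda>M::'a multiset. to_nat (SOME xs. mset xs = M))"
  proof (rule injI)
    fix M N :: "'a multiset"
    assume "to_nat (SOME xs. mset xs = M) = to_nat (SOME xs. mset xs = N)"
    then have "(SOME xs. mset xs = M) = (SOME xs. mset xs = N)" by simp
    moreover have "mset (SOME xs. mset xs = M) = M" "mset (SOME xs. mset xs = N) = N"
      by (rule someI_ex, rule ex_mset)+
    ultimately show "M = N" by metis
  qed
  then show "\<exists>to_nat::'a multiset \<Rightarrow> nat. inj to_nat" by blast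
qed

instance rps :: countable by countable_datatype
instance typed_graph :: countable by countable_datatype

lemma degree_attach:
  "degree (attach g (u, v)) w = degree g w + of_bool (w = u) + of_bool (w = v)
     + 2 * of_bool (w = length (vtypes g))"
  by (simp add: degree_def attach_def)

lemma verts_attach: "verts (attach g (u, v)) = insert (length (vtypes g)) (verts g)"
  by (auto simp: verts_def attach_def)

lemma wf_attach:
  assumes "wf_graph g" "u \<in> verts g" "v \<in> verts g"
  shows "wf_graph (attach g (u, v))"
  using assms unfolding wf_graph_def verts_attach by (auto simp: attach_def)

lemma type_degree_attach:
  assumes "wf_graph g" "u \<in> verts g" "v \<in> verts g"
  shows "type_degree (attach g (u, v)) t = type_degree g t + of_bool (vtypes g ! u = t)
    + of_bool (vtypes g ! v = t) + 2 * of_bool (winner (vtypes g ! u) (vtypes g ! v) = t)"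
proof -
  let ?g = "attach g (u, v)" and ?l = "length (vtypes g)"
  let ?S = "{w. w \<in> verts g \<and> vtypes g ! w = t}"
  have fin: "finite ?S" by (simp add: verts_def)
  have l: "?l \<notin> verts g" by (simp add: verts_def)
  have ty: "vtypes ?g ! w = (if w = ?l then winner (vtypes g ! u) (vtypes g ! v) else vtypes g ! w)"
    if "w \<in> verts ?g" for w
    using that by (auto simp: verts_attach verts_def attach_def nth_append)
  have S: "{w. w \<in> verts ?g \<and> vtypes ?g ! w = t}
      = (if winner (vtypes g ! u) (vtypes g ! v) = t then insert ?l ?S else ?S)"
    using l by (auto simp: ty verts_attach)
  have dS: "(\<Sum>w\<in>?S. degree ?g w) = type_degree g t + of_bool (vtypes g ! u = t) + of_bool (vtypes g ! v = t)"
  proof -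
    have "(\<Sum>w\<in>?S. degree ?g w) = (\<Sum>w\<in>?S. degree g w + of_bool (w = u) + of_bool (w = v))"
      using l by (intro sum.cong) (auto simp: degree_attach)
    also have "\<dots> = type_degree g t + (\<Sum>w\<in>?S. of_bool (w = u)) + (\<Sum>w\<in>?S. of_bool (w = v))"
      by (simp add: sum.distrib type_degree_def)
    also have "(\<Sum>w\<in>?S. of_bool (w = u)) = (of_bool (vtypes g ! u = t) :: nat)"
      using fin assms by (auto simp: of_bool_def sum.delta)
    also have "(\<Sum>w\<in>?S. of_bool (w = v)) = (of_bool (vtypes g ! v = t) :: nat)"
      using fin assms by (auto simp: of_bool_def sum.delta)
    finally show ?thesis .
  qed
  have "degree ?g ?l = 2"
    using assms l degree_eq_0[OF assms(1) l] by (auto simp: degree_attach)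
  then show ?thesis
    unfolding type_degree_def[of ?g] S using dS fin l by auto
qed

lemma total_degree_types:
  "total_degree g = type_degree g Rock + type_degree g Paper + type_degree g Scissors"
proof -
  have fin: "finite {v. v \<in> verts g \<and> P v}" for P by (simp add: verts_def)
  have "verts g = {v. v \<in> verts g \<and> vtypes g ! v = Rock} \<union> {v. v \<in> verts g \<and> vtypes g ! v = Paper}
      \<union> {v. v \<in> verts g \<and> vtypes g ! v = Scissors}" using rps.exhaust by auto
  then have "total_degree g = (\<Sum>v\<in>{v. v \<in> verts g \<and> vtypes g ! v = Rock} \<union> {v. v \<in> verts g \<and> vtypes g ! v = Paper}
      \<union> {v. v \<in> verts g \<and> vtypes g ! v = Scissors}. degree g v)" unfolding total_degree_def by presburger
  then show ?thesis unfolding type_degree_def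
    by (subst (asm) sum.union_disjoint) (auto simp: fin intro!: sum.union_disjoint)
qed

text \<open>
  The coordinates of the urn, as real numbers.
\<close>
definition rocks :: "typed_graph \<Rightarrow> real" where "rocks g = real (type_degree g Rock)"
definition papers :: "typed_graph \<Rightarrow> real" where "papers g = real (type_degree g Paper)"
definition scissors :: "typed_graph \<Rightarrow> real" where "scissors g = real (type_degree g Scissors)"

text \<open>
  The properties that hold at time 0 and are preserved by every step.
\<close>
definition good :: "typed_graph \<Rightarrow> bool" where
  "good g \<longleftrightarrow> wf_graph g \<and> 1 \<le> rocks g \<and> 1 \<le> papers g \<and> 1 \<le> scissors g"

lemma total_degree_real: "real (total_degree g) = rocks g + papers g + scissors g"
  by (simp add: total_degree_types rocks_def papers_def scissors_def)

lemma good_total: "good g \<Longrightarrow> 0 < total_degree g"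
  using total_degree_real[of g] by (simp add: good_def flip: of_nat_0_less_iff)

text \<open>
  The gain of type \<open>r\<close> when the types \<open>s\<close> and \<open>t\<close> are chosen.
\<close>
definition step_move :: "rps \<Rightarrow> rps \<Rightarrow> rps \<Rightarrow> real" where
  "step_move s t r = of_bool (s = r) + of_bool (t = r) + 2 * of_bool (winner s t = r)"

lemma set_choose_vertex:
  assumes "good g"
  shows "set_pmf (choose_vertex g) \<subseteq> verts g"
proof
  fix v assume "v \<in> set_pmf (choose_vertex g)"
  then have "degree g v \<noteq> 0"
    using assms good_total[OF assms] pmf_choose_vertex[of g v] by (auto simp: set_pmf_iff good_def)
  then show "v \<in> verts g" using degree_eq_0[of g v] assms by (auto simp: good_def)
qed

lemma step_move_move: "move (step_move s t Rock) (step_move s t Paper) (step_move s t Scissors)"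
  by (cases s; cases t) (auto simp: move_def step_move_def)

lemma attach_counts:
  assumes "good g" "u \<in> verts g" "v \<in> verts g"
  shows "rocks (attach g (u, v)) = rocks g + step_move (vtypes g ! u) (vtypes g ! v) Rock"
    and "papers (attach g (u, v)) = papers g + step_move (vtypes g ! u) (vtypes g ! v) Paper"
    and "scissors (attach g (u, v)) = scissors g + step_move (vtypes g ! u) (vtypes g ! v) Scissors"
  using assms by (auto simp: rocks_def papers_def scissors_def type_degree_attach good_def step_move_def)

lemma finite_rps_step:
  assumes "good g"
  shows "finite (set_pmf (rps_step g))"
  using finite_subset[OF set_choose_vertex[OF assms]]
  by (simp add: rps_step_def verts_def)

lemma rps_step_good:
  assumes "good g" "g' \<in> set_pmf (rps_step g)"
  shows "good g'" and "move (rocks g' - rocks g) (papers g' - papers g) (scissors g' - scissors g)"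
proof -
  obtain u v where uv: "u \<in> verts g" "v \<in> verts g" "g' = attach g (u, v)"
    using assms set_choose_vertex[OF assms(1)] by (auto simp: rps_step_def)
  show m: "move (rocks g' - rocks g) (papers g' - papers g) (scissors g' - scissors g)"
    using attach_counts[OF assms(1) uv(1,2)] step_move_move by (simp add: uv(3))
  show "good g'"
    using moveD[OF m] assms(1) uv wf_attach[of g u v] by (auto simp: good_def)
qed

lemma pmf_vertex_type:
  assumes "good g"
  shows "pmf (map_pmf (\<lambda>v. vtypes g ! v) (choose_vertex g)) t = share g t"
proof -
  let ?S = "{v. v \<in> verts g \<and> vtypes g ! v = t}"
  have fin: "finite ?S" by (simp add: verts_def)
  have "pmf (map_pmf (\<lambda>v. vtypes g ! v) (choose_vertex g)) t
      = measure (choose_vertex g) ((\<lambda>v. vtypes g ! v) -` {t})"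
    by (simp add: pmf_map)
  also have "\<dots> = measure (choose_vertex g) ?S"
    using set_choose_vertex[OF assms] by (intro measure_pmf.finite_measure_eq_AE) (auto simp: AE_measure_pmf_iff)
  also have "\<dots> = (\<Sum>v\<in>?S. pmf (choose_vertex g) v)"
    using fin by (rule measure_measure_pmf_finite)
  also have "\<dots> = share g t"
    using assms good_total[OF assms]
    by (simp add: pmf_choose_vertex good_def share_def type_degree_def sum_divide_distrib)
  finally show ?thesis .
qed

lemma expectation_rps_step:
  assumes "good g"
  shows "measure_pmf.expectation (rps_step g) (\<lambda>g'. f (rocks g') (papers g') (scissors g'))
    = avg (rocks g) (papers g) (scissors g)
        (\<lambda>i j k. f (rocks g + i) (papers g + j) (scissors g + k))"
proof -
  define T where "T = map_pmf (\<lambda>v. vtypes g ! v) (choose_vertex g)"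
  define F where "F = (\<lambda>(s, t). f (rocks g + step_move s t Rock) (papers g + step_move s t Paper)
      (scissors g + step_move s t Scissors))"
  have "measure_pmf.expectation (rps_step g) (\<lambda>g'. f (rocks g') (papers g') (scissors g'))
    = measure_pmf.expectation (pair_pmf (choose_vertex g) (choose_vertex g))
        (\<lambda>(u, v). F (vtypes g ! u, vtypes g ! v))"
    unfolding rps_step_def using set_choose_vertex[OF assms] attach_counts[OF assms]
    by (auto simp: AE_measure_pmf_iff F_def subset_iff intro!: integral_cong_AE)
  also have "\<dots> = measure_pmf.expectation (pair_pmf T T) F"
    unfolding T_def map_pair[symmetric] by (simp add: split_beta')
  also have "\<dots> = (\<Sum>st\<in>{Rock, Paper, Scissors} \<times> {Rock, Paper, Scissors}. F st * pmf (pair_pmf T T) st)"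
    by (rule integral_measure_pmf_real) (use rps.exhaust in auto)
  also have "\<dots> = (\<Sum>s\<in>{Rock, Paper, Scissors}. \<Sum>t\<in>{Rock, Paper, Scissors}. F (s, t) * (share g s * share g t))"
    by (simp add: sum.cartesian_product[symmetric] pmf_pair T_def pmf_vertex_type[OF assms] case_prod_beta)
  also have "\<dots> = avg (rocks g) (papers g) (scissors g)
        (\<lambda>i j k. f (rocks g + i) (papers g + j) (scissors g + k))"
    by (simp add: F_def step_move_def avg_def share_def total_degree_real add_divide_distrib
        power2_eq_square flip: rocks_def papers_def scissors_def) (simp add: algebra_simps)
  finally show ?thesis .
qed

text \<open>
  A process started from a graph in which all three types have positive degree.
\<close>
locale rps_setting = prob_space P for P :: "'w measure" +
  fixes G0 :: typed_graph and G :: "nat \<Rightarrow> 'w \<Rightarrow> typed_graph"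
  assumes good0: "good G0" and process: "rps_process P G0 G"
begin

lemma G_measurable [measurable]: "G n \<in> measurable P (count_space UNIV)"
  using process by (simp add: rps_process_def)

text \<open>
  The list of graphs up to and including time \<open>n\<close>.
\<close>
definition hist :: "nat \<Rightarrow> 'w \<Rightarrow> typed_graph list" where
  "hist n \<omega> = map (\<lambda>i. G i \<omega>) [0..<Suc n]"

lemma hist_Suc: "hist (Suc n) \<omega> = hist n \<omega> @ [G (Suc n) \<omega>]"
  by (simp add: hist_def)

lemma length_hist [simp]: "length (hist n \<omega>) = Suc n"
  by (simp add: hist_def)

lemma nth_hist: "i \<le> n \<Longrightarrow> hist n \<omega> ! i = G i \<omega>"
  by (simp add: hist_def nth_append del: upt_Suc)

lemma last_hist: "last (hist n \<omega>) = G n \<omega>"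
  by (simp add: hist_def)

lemma hist_measurable [measurable]: "hist n \<in> measurable P (count_space UNIV)"
proof (induction n)
  case 0
  have "hist 0 = (\<lambda>\<omega>. [G 0 \<omega>])" by (rule ext) (simp add: hist_def)
  then show ?case by simp
next
  case (Suc n)
  have "(\<lambda>\<omega>. (\<lambda>h \<omega>. h @ [G (Suc n) \<omega>]) (hist n \<omega>) \<omega>) \<in> measurable P (count_space UNIV)"
    by (rule measurable_compose_countable[OF _ Suc]) simp
  then show ?case by (simp add: hist_Suc[abs_def])
qed

text \<open>
  The law of the history, built from the transition probabilities.
\<close>
primrec histlaw :: "nat \<Rightarrow> typed_graph list pmf" where
  "histlaw 0 = return_pmf [G0]"
| "histlaw (Suc n) = bind_pmf (histlaw n) (\<lambda>h. map_pmf (\<lambda>g. h @ [g]) (rps_step (last h)))"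

lemma length_histlaw: "h \<in> set_pmf (histlaw n) \<Longrightarrow> length h = Suc n"
  by (induction n arbitrary: h) auto

lemma pmf_histlaw_snoc:
  "pmf (histlaw (Suc n)) (h @ [g]) = pmf (histlaw n) h * pmf (rps_step (last h)) g"
proof -
  have "pmf (map_pmf (\<lambda>g. h' @ [g]) (rps_step (last h'))) (h @ [g])
      = indicator {h} h' * pmf (rps_step (last h)) g" for h'
  proof (cases "h' = h")
    case True
    have "inj (\<lambda>g. h @ [g])" by (simp add: inj_on_def)
    then show ?thesis using True pmf_map_inj'[of "\<lambda>g. h @ [g]" "rps_step (last h)" g] by simp
  next
    case False
    then have "(h @ [g]) \<notin> set_pmf (map_pmf (\<lambda>g. h' @ [g]) (rps_step (last h')))" by auto
    then show ?thesis using False by (simp add: set_pmf_iff del: set_map_pmf)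
  qed
  then show ?thesis by (simp add: pmf_bind measure_pmf_single)
qed

lemma measure_hist: "measure P {\<omega> \<in> space P. hist n \<omega> = h} = pmf (histlaw n) h"
proof (induction n arbitrary: h)
  case 0
  have ae: "AE \<omega> in P. G 0 \<omega> = G0" using process by (simp add: rps_process_def)
  have "measure P {\<omega> \<in> space P. hist 0 \<omega> = h} = measure P (if h = [G0] then space P else {})"
    by (rule finite_measure_eq_AE) (use ae in \<open>auto simp: hist_def\<close>)
  then show ?case by (simp add: prob_space)
next
  case (Suc n)
  show ?case
  proof (cases "length h = Suc (Suc n)")
    case True
    then obtain h' g where h: "h = h' @ [g]" "length h' = Suc n"
      by (metis length_Suc_conv_rev)
    have "measure P {\<omega> \<in> space P. hist (Suc n) \<omega> = h} = measure P {\<omega> \<in> space P. \<forall>i\<le>Suc n. G i \<omega> = h ! i}"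
      by (rule arg_cong[where f="measure P"])
         (auto simp: list_eq_iff_nth_eq True nth_hist less_Suc_eq_le)
    also have "\<dots> = measure P {\<omega> \<in> space P. \<forall>i\<le>n. G i \<omega> = h ! i} * pmf (rps_step (h ! n)) (h ! Suc n)"
      using process by (simp add: rps_process_def)
    also have "{\<omega> \<in> space P. \<forall>i\<le>n. G i \<omega> = h ! i} = {\<omega> \<in> space P. hist n \<omega> = h'}"
      by (auto simp: list_eq_iff_nth_eq h nth_hist less_Suc_eq_le nth_append)
    also have "h ! n = last h'" using h by (cases h' rule: rev_cases) (auto simp: nth_append)
    also have "h ! Suc n = g" using h by (simp add: nth_append)
    finally show ?thesis using Suc[of h'] pmf_histlaw_snoc[of n h' g] by (simp add: h(1))
  next
    case False
    then have "{\<omega> \<in> space P. hist (Suc n) \<omega> = h} = {}" by auto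
    moreover have "pmf (histlaw (Suc n)) h = 0"
      using False length_histlaw[of h "Suc n"] by (auto simp: set_pmf_iff simp del: histlaw.simps)
    ultimately show ?thesis by (simp only: measure_empty)
  qed
qed

lemma distr_hist: "distr P (count_space UNIV) (hist n) = measure_pmf (histlaw n)"
proof (rule measure_eqI_countable)
  fix h
  have "emeasure (distr P (count_space UNIV) (hist n)) {h} = emeasure P {\<omega> \<in> space P. hist n \<omega> = h}"
    by (subst emeasure_distr) (auto intro!: arg_cong[where f="emeasure P"])
  then show "emeasure (distr P (count_space UNIV) (hist n)) {h} = emeasure (histlaw n) {h}"
    by (simp add: emeasure_eq_measure measure_hist emeasure_pmf_single)
qed auto

lemma histlaw_good:
  assumes "h \<in> set_pmf (histlaw n)"
  shows "good (last h)"
  using assms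
proof (induction n arbitrary: h)
  case (Suc n)
  then obtain h' g where "h' \<in> set_pmf (histlaw n)" "g \<in> set_pmf (rps_step (last h'))" "h = h' @ [g]"
    by auto
  then show ?case using rps_step_good(1)[OF Suc.IH] by simp
qed (simp add: good0)

lemma finite_histlaw: "finite (set_pmf (histlaw n))"
  by (induction n) (auto intro!: finite_rps_step simp: histlaw_good)

text \<open>
  The random variable is a function of the graphs up to time \<open>n\<close>. These variables stand in for
  those measurable with respect to the natural filtration.
\<close>
definition past :: "nat \<Rightarrow> ('w \<Rightarrow> real) \<Rightarrow> bool" where
  "past n W \<longleftrightarrow> (\<exists>\<phi>. W = (\<lambda>\<omega>. \<phi> (hist n \<omega>)))"

lemma past_G: "i \<le> n \<Longrightarrow> past n (\<lambda>\<omega>. f (G i \<omega>))"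
  unfolding past_def by (rule exI[of _ "\<lambda>h. f (h ! i)"]) (simp add: nth_hist)

lemma past_comb: "past n V \<Longrightarrow> past n W \<Longrightarrow> past n (\<lambda>\<omega>. f (V \<omega>) (W \<omega>))"
  unfolding past_def by fastforce

lemma past_Suc: 
  assumes "past n W" shows "past (Suc n) W"
proof -
  obtain \<phi> where "W = (\<lambda>\<omega>. \<phi> (hist n \<omega>))" using assms by (auto simp: past_def)
  then have "W = (\<lambda>\<omega>. (\<lambda>h. \<phi> (butlast h)) (hist (Suc n) \<omega>))" by (simp add: hist_Suc)
  then show ?thesis unfolding past_def by (rule exI[of _ "\<lambda>h. \<phi> (butlast h)"])
qed

lemma past_mono: "n \<le> k \<Longrightarrow> past n W \<Longrightarrow> past k W"
  by (induction k rule: dec_induct) (auto intro: past_Suc)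

lemma past_measurable: "past n W \<Longrightarrow> W \<in> borel_measurable P"
  by (auto simp: past_def)

lemma integrable_hist: "integrable P (\<lambda>\<omega>. (\<phi> (hist n \<omega>) :: real))"
proof -
  have "integrable (measure_pmf (histlaw n)) \<phi>"
    by (rule integrable_measure_pmf_finite[OF finite_histlaw])
  then show ?thesis unfolding distr_hist[symmetric]
    by (subst (asm) integrable_distr_eq) auto
qed

lemma past_integrable: "past n W \<Longrightarrow> integrable P W"
  using integrable_hist by (auto simp: past_def)

lemma expectation_hist: "expectation (\<lambda>\<omega>. \<phi> (hist n \<omega>)) = measure_pmf.expectation (histlaw n) \<phi>" for \<phi> :: "_ \<Rightarrow> real"
  unfolding distr_hist[symmetric] by (subst integral_distr) auto

abbreviation "A n \<omega> \<equiv> rocks (G n \<omega>)"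
abbreviation "B n \<omega> \<equiv> papers (G n \<omega>)"
abbreviation "C n \<omega> \<equiv> scissors (G n \<omega>)"

text \<open>
  The Markov property, tested against weights that depend on the past; it replaces
  conditional expectations throughout.
\<close>
lemma markov:
  assumes "past n W"
  shows "expectation (\<lambda>\<omega>. W \<omega> * f (A (Suc n) \<omega>) (B (Suc n) \<omega>) (C (Suc n) \<omega>))
    = expectation (\<lambda>\<omega>. W \<omega> * avg (A n \<omega>) (B n \<omega>) (C n \<omega>) (\<lambda>i j k. f (A n \<omega> + i) (B n \<omega> + j) (C n \<omega> + k)))"
proof -
  obtain \<phi> where W: "W = (\<lambda>\<omega>. \<phi> (hist n \<omega>))" using assms by (auto simp: past_def)
  define F where "F g = f (rocks g) (papers g) (scissors g)" for g
  define K where "K g = avg (rocks g) (papers g) (scissors g) (\<lambda>i j k. f (rocks g + i) (papers g + j) (scissors g + k))" for g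
  have "expectation (\<lambda>\<omega>. W \<omega> * F (G (Suc n) \<omega>))
      = expectation (\<lambda>\<omega>. (\<lambda>h. \<phi> (butlast h) * F (last h)) (hist (Suc n) \<omega>))"
    by (simp add: W hist_Suc)
  also have "\<dots> = measure_pmf.expectation (histlaw (Suc n)) (\<lambda>h. \<phi> (butlast h) * F (last h))"
    by (rule expectation_hist)
  also have "\<dots> = (\<Sum>h\<in>set_pmf (histlaw n). pmf (histlaw n) h *\<^sub>R
      measure_pmf.expectation (map_pmf (\<lambda>g. h @ [g]) (rps_step (last h))) (\<lambda>h. \<phi> (butlast h) * F (last h)))"
    unfolding histlaw.simps
    by (rule pmf_expectation_bind) (auto simp: finite_histlaw finite_rps_step histlaw_good)
  also have "\<dots> = (\<Sum>h\<in>set_pmf (histlaw n). \<phi> h * K (last h) * pmf (histlaw n) h)"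
    using expectation_rps_step[OF histlaw_good, of _ n f]
    by (intro sum.cong) (simp_all add: F_def K_def)
  also have "\<dots> = measure_pmf.expectation (histlaw n) (\<lambda>h. \<phi> h * K (last h))"
    by (rule integral_measure_pmf_real[symmetric]) (auto simp: finite_histlaw)
  also have "\<dots> = expectation (\<lambda>\<omega>. (\<lambda>h. \<phi> h * K (last h)) (hist n \<omega>))"
    by (rule expectation_hist[symmetric])
  finally show ?thesis by (simp add: W F_def K_def last_hist)
qed

lemma AE_hist:
  assumes "\<And>h. h \<in> set_pmf (histlaw n) \<Longrightarrow> Q h"
  shows "AE \<omega> in P. Q (hist n \<omega>)"
proof -
  have "AE h in distr P (count_space UNIV) (hist n). Q h"
    unfolding distr_hist using assms by (simp add: AE_measure_pmf_iff)
  then show ?thesis by (subst (asm) AE_distr_iff) auto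
qed

lemma AE_good: "AE \<omega> in P. \<forall>n. good (G n \<omega>)"
  unfolding AE_all_countable using AE_hist[where Q="\<lambda>h. good (last h)"] histlaw_good
  by (auto simp: last_hist)

lemma AE_move: "AE \<omega> in P. \<forall>n. move (A (Suc n) \<omega> - A n \<omega>) (B (Suc n) \<omega> - B n \<omega>) (C (Suc n) \<omega> - C n \<omega>)"
  unfolding AE_all_countable
proof
  fix n
  let ?Q = "\<lambda>h. move (rocks (last h) - rocks (last (butlast h))) (papers (last h) - papers (last (butlast h)))
    (scissors (last h) - scissors (last (butlast h)))"
  have "AE \<omega> in P. ?Q (hist (Suc n) \<omega>)"
    by (rule AE_hist) (auto simp: histlaw_good rps_step_good)
  then show "AE \<omega> in P. move (A (Suc n) \<omega> - A n \<omega>) (B (Suc n) \<omega> - B n \<omega>) (C (Suc n) \<omega> - C n \<omega>)"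
    by (simp add: hist_Suc last_hist)
qed

text \<open>
  The total degree at time 0; at time \<open>n\<close> it is \<open>T0 + 4 n\<close>.
\<close>
definition T0 :: real where "T0 = rocks G0 + papers G0 + scissors G0"

text \<open>
  The almost sure event on which all pathwise arguments take place.
\<close>
definition regular :: "'w \<Rightarrow> bool" where
  "regular \<omega> \<longleftrightarrow> (\<forall>n. good (G n \<omega>)) \<and> 
     (\<forall>n. move (A (Suc n) \<omega> - A n \<omega>) (B (Suc n) \<omega> - B n \<omega>) (C (Suc n) \<omega> - C n \<omega>)) \<and> G 0 \<omega> = G0"

lemma AE_regular: "AE \<omega> in P. regular \<omega>"
  using AE_good AE_move process unfolding regular_def rps_process_def by auto

lemma T0_ge: "3 \<le> T0"
  using good0 by (simp add: T0_def good_def)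

lemma regularD:
  assumes "regular \<omega>"
  shows "1 \<le> A n \<omega>" "1 \<le> B n \<omega>" "1 \<le> C n \<omega>" "A n \<omega> + B n \<omega> + C n \<omega> = T0 + 4 * real n"
    and "move (A (Suc n) \<omega> - A n \<omega>) (B (Suc n) \<omega> - B n \<omega>) (C (Suc n) \<omega> - C n \<omega>)"
proof -
  show m: "move (A (Suc n) \<omega> - A n \<omega>) (B (Suc n) \<omega> - B n \<omega>) (C (Suc n) \<omega> - C n \<omega>)" for n
    using assms by (simp add: regular_def)
  show "1 \<le> A n \<omega>" "1 \<le> B n \<omega>" "1 \<le> C n \<omega>"
    using assms by (auto simp: regular_def good_def)
  show "A n \<omega> + B n \<omega> + C n \<omega> = T0 + 4 * real n"
  proof (induction n)
    case 0
    then show ?case using assms by (simp add: regular_def T0_def)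
  next
    case (Suc n)
    then show ?case using moveD(7)[OF m[of n]] by simp
  qed
qed

section \<open>Almost sure convergence of the product of the shares\<close>


text \<open>
  The product of the shares at time \<open>n\<close> and its limit; \<open>lim\<close> is arbitrary on the null set of
  divergence.
\<close>
definition M :: "nat \<Rightarrow> 'w \<Rightarrow> real" where "M n \<omega> = level (A n \<omega>) (B n \<omega>) (C n \<omega>)"
definition Mlim :: "'w \<Rightarrow> real" where "Mlim \<omega> = lim (\<lambda>n. M n \<omega>)"

lemma past_state: "past n (\<lambda>\<omega>. f (A n \<omega>) (B n \<omega>) (C n \<omega>))"
  by (rule past_G[OF order_refl, of _ "\<lambda>g. f (rocks g) (papers g) (scissors g)"])

lemma past_const: "past n (\<lambda>\<omega>. r)"
  using past_state[of n "\<lambda>_ _ _. r"] .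

lemma M_measurable [measurable]: "M n \<in> borel_measurable P"
  unfolding M_def[abs_def] by (rule past_measurable[OF past_state])

lemma Mlim_measurable [measurable]: "Mlim \<in> borel_measurable P"
  unfolding Mlim_def[abs_def] by measurable

lemma T_gt: "real n + 1 \<le> T0 + 4 * real n" "0 < T0 + 4 * real n" "1 \<le> T0 + 4 * real n" "3 \<le> T0 + 4 * real n"
  using T0_ge by auto

lemma regular_step:
  assumes "regular \<omega>"
  obtains i j k where "move i j k" "A (Suc n) \<omega> = A n \<omega> + i" "B (Suc n) \<omega> = B n \<omega> + j" "C (Suc n) \<omega> = C n \<omega> + k"
  using regularD(5)[OF assms, of n] by (metis add_diff_cancel_left' add.commute diff_add_cancel)

text \<open>
  The martingale part of any function of the state with increments \<open>O(1/t)\<close> converges.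
\<close>
lemma noise_summable:
  assumes u: "\<And>a b c i j k. 1 \<le> a \<Longrightarrow> 1 \<le> b \<Longrightarrow> 1 \<le> c \<Longrightarrow> move i j k \<Longrightarrow>
      \<bar>u (a+i) (b+j) (c+k) - u a b c\<bar> \<le> K / (a+b+c)"
  shows "AE \<omega> in P. summable (\<lambda>n. u (A (Suc n) \<omega>) (B (Suc n) \<omega>) (C (Suc n) \<omega>)
     - avg (A n \<omega>) (B n \<omega>) (C n \<omega>) (\<lambda>i j k. u (A n \<omega> + i) (B n \<omega> + j) (C n \<omega> + k)))"
proof -
  define v where "v a b c = avg a b c (\<lambda>i j k. u (a+i) (b+j) (c+k))" for a b c
  define f where "f n \<omega> = u (A (Suc n) \<omega>) (B (Suc n) \<omega>) (C (Suc n) \<omega>) - v (A n \<omega>) (B n \<omega>) (C n \<omega>)" for n \<omega>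
  have pf: "past (Suc n) (f n)" for n
    unfolding f_def[abs_def] by (intro past_comb[where f="(-)"] past_state past_Suc)
  have v: "\<bar>v a b c - u a b c\<bar> \<le> K / (a+b+c)" if abc: "1 \<le> a" "1 \<le> b" "1 \<le> c" for a b c
  proof -
    have "v a b c \<le> avg a b c (\<lambda>i j k. u a b c + K / (a+b+c))"
      unfolding v_def using abc u[OF abc] by (intro avg_mono) (auto simp: abs_le_iff algebra_simps)
    moreover have "avg a b c (\<lambda>i j k. u a b c - K / (a+b+c)) \<le> v a b c"
      unfolding v_def using abc u[OF abc] by (intro avg_mono) (auto simp: abs_le_iff algebra_simps)
    ultimately show ?thesis using abc by (simp add: avg_const abs_le_iff)
  qed
  have K: "0 \<le> K"
  proof -
    have "0 \<le> K / (1+1+1)" using v[of 1 1 1] abs_ge_zero order_trans by (metis order_refl)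
    then show ?thesis by simp
  qed
  have bd: "\<bar>f n \<omega>\<bar> \<le> 2 * K / (real n + 1)" if r: "regular \<omega>" for n \<omega>
  proof -
    obtain i j k where ijk: "move i j k" "A (Suc n) \<omega> = A n \<omega> + i" "B (Suc n) \<omega> = B n \<omega> + j" "C (Suc n) \<omega> = C n \<omega> + k"
      using regular_step[OF r] .
    note R = regularD[OF r, of n]
    have "\<bar>f n \<omega>\<bar> \<le> K / (T0 + 4 * real n) + K / (T0 + 4 * real n)"
      using u[OF R(1-3) ijk(1)] v[OF R(1-3)] unfolding f_def ijk(2-4) R(4) by linarith
    also have "K / (T0 + 4 * real n) \<le> K / (real n + 1)"
      using K T_gt(1,2)[of n] by (intro divide_left_mono mult_pos_pos) auto
    finally show ?thesis by simp
  qed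
  have "AE \<omega> in P. summable (\<lambda>n. f n \<omega>)"
  proof (rule orthogonal_series_summable)
    show "f n \<in> borel_measurable P" for n using pf by (rule past_measurable)
    show "integrable P (\<lambda>\<omega>. f i \<omega> * f j \<omega>)" for i j
      by (rule past_integrable[OF past_comb[where f="(*)" and n="max (Suc i) (Suc j)"]])
         (auto intro: past_mono[OF _ pf])
    show "AE \<omega> in P. \<forall>n. \<bar>f n \<omega>\<bar> \<le> 2 * K / (real n + 1)"
      using AE_regular bd by (auto elim: eventually_mono)
    fix i j :: nat assume "i < j"
    then have pi: "past j (f i)" by (intro past_mono[OF _ pf]) auto
    have "expectation (\<lambda>\<omega>. f i \<omega> * f j \<omega>)
        = expectation (\<lambda>\<omega>. f i \<omega> * u (A (Suc j) \<omega>) (B (Suc j) \<omega>) (C (Suc j) \<omega>) - f i \<omega> * v (A j \<omega>) (B j \<omega>) (C j \<omega>))"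
      by (simp only: f_def[of j] right_diff_distrib)
    also have "\<dots> = expectation (\<lambda>\<omega>. f i \<omega> * u (A (Suc j) \<omega>) (B (Suc j) \<omega>) (C (Suc j) \<omega>))
        - expectation (\<lambda>\<omega>. f i \<omega> * v (A j \<omega>) (B j \<omega>) (C j \<omega>))"
      by (intro Bochner_Integration.integral_diff past_integrable[where n="Suc j"] past_comb[where f="(*)"]
          past_Suc[OF pi] past_state past_Suc[OF past_state])
    also have "\<dots> = 0" unfolding markov[OF pi, of u] v_def by simp
    finally show "expectation (\<lambda>\<omega>. f i \<omega> * f j \<omega>) = 0" .
  qed
  then show ?thesis by (simp add: f_def v_def)
qed

lemma supermart_expectation:
  assumes f: "supermart f" and W: "past n W" "\<And>\<omega>. 0 \<le> W \<omega>" and k: "n \<le> k"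
  shows "expectation (\<lambda>\<omega>. W \<omega> * f (A k \<omega>) (B k \<omega>) (C k \<omega>))
     \<le> expectation (\<lambda>\<omega>. W \<omega> * f (A n \<omega>) (B n \<omega>) (C n \<omega>))"
  using k
proof (induction k rule: dec_induct)
  case (step k)
  have pk: "past k W" using past_mono[OF step(1) W(1)] .
  have "expectation (\<lambda>\<omega>. W \<omega> * f (A (Suc k) \<omega>) (B (Suc k) \<omega>) (C (Suc k) \<omega>))
      = expectation (\<lambda>\<omega>. W \<omega> * avg (A k \<omega>) (B k \<omega>) (C k \<omega>) (\<lambda>i j l. f (A k \<omega> + i) (B k \<omega> + j) (C k \<omega> + l)))"
    by (rule markov[OF pk])
  also have "\<dots> \<le> expectation (\<lambda>\<omega>. W \<omega> * f (A k \<omega>) (B k \<omega>) (C k \<omega>))"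
  proof (rule integral_mono_AE)
    show "integrable P (\<lambda>\<omega>. W \<omega> * avg (A k \<omega>) (B k \<omega>) (C k \<omega>) (\<lambda>i j l. f (A k \<omega> + i) (B k \<omega> + j) (C k \<omega> + l)))"
      by (rule past_integrable[OF past_comb[where f="(*)", OF pk
        past_state[of k "\<lambda>a b c. avg a b c (\<lambda>i j l. f (a + i) (b + j) (c + l))"]]])
    show "integrable P (\<lambda>\<omega>. W \<omega> * f (A k \<omega>) (B k \<omega>) (C k \<omega>))"
      by (rule past_integrable[OF past_comb[where f="(*)", OF pk past_state]])
    show "AE \<omega> in P. W \<omega> * avg (A k \<omega>) (B k \<omega>) (C k \<omega>) (\<lambda>i j l. f (A k \<omega> + i) (B k \<omega> + j) (C k \<omega> + l))
        \<le> W \<omega> * f (A k \<omega>) (B k \<omega>) (C k \<omega>)"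
      using AE_regular
    proof eventually_elim
      case (elim \<omega>)
      then show ?case using f regularD[OF elim, of k] W(2) unfolding supermart_def
        by (intro mult_left_mono) auto
    qed
  qed
  finally show ?case using step(3) by linarith
qed simp

lemma level_unit:
  assumes "regular \<omega>"
  shows "0 < M n \<omega>" "M n \<omega> \<le> 1/27"
  using level_bounds[of "A n \<omega>" "B n \<omega>" "C n \<omega>"] regularD(1-3)[OF assms, of n] by (auto simp: M_def)

lemma M_converges: "AE \<omega> in P. regular \<omega> \<and> (\<lambda>n. M n \<omega>) \<longlonglongrightarrow> Mlim \<omega> \<and> 0 \<le> Mlim \<omega> \<and> Mlim \<omega> \<le> 1/27"
proof -
  have "AE \<omega> in P. summable (\<lambda>n. level (A (Suc n) \<omega>) (B (Suc n) \<omega>) (C (Suc n) \<omega>)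
     - avg (A n \<omega>) (B n \<omega>) (C n \<omega>) (\<lambda>i j k. level (A n \<omega> + i) (B n \<omega> + j) (C n \<omega> + k)))"
    by (rule noise_summable) (auto intro!: level_step(1))
  with AE_regular show ?thesis
  proof eventually_elim
    case (elim \<omega>)
    define t where "t n = T0 + 4 * real n" for n
    define d where "d n = M n \<omega> * ((30 * t n + 64) / (t n + 4)^3)" for n
    have av: "avg (A n \<omega>) (B n \<omega>) (C n \<omega>) (\<lambda>i j k. level (A n \<omega> + i) (B n \<omega> + j) (C n \<omega> + k)) = M n \<omega> - d n" for n
      using regularD(1-4)[OF elim(1), of n] avg_level[of "A n \<omega>" "B n \<omega>" "C n \<omega>"]
      by (simp add: M_def d_def t_def right_diff_distrib)
    have "summable d"
    proof (rule summable_comparison_test')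
      show "summable (\<lambda>n. 30 * (1 / (real n + 1)^2))"
        using summable_inverse_squares[of 30] by simp
      fix n :: nat
      note mu = level_unit[OF elim(1), of n]
      have t: "3 \<le> t n" "real n + 1 \<le> t n" using T_gt[of n] by (auto simp: t_def)
      have "0 \<le> d n" unfolding d_def using mu drift_bounds(2)[OF t(1)] by (intro mult_nonneg_nonneg) auto
      moreover have "d n \<le> 1 * (30 / (t n)\<^sup>2)" unfolding d_def
        using mu drift_bounds(2,4)[OF t(1)] by (intro mult_mono) auto
      moreover have "30 / (t n)\<^sup>2 \<le> 30 / (real n + 1)\<^sup>2"
        using t by (intro divide_left_mono power_mono mult_pos_pos) auto
      ultimately show "norm (d n) \<le> 30 * (1 / (real n + 1)^2)" by simp
    qed
    with elim(2) have "summable (\<lambda>n. (M (Suc n) \<omega> - (M n \<omega> - d n)) - d n)"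
      unfolding av M_def[symmetric] by (rule summable_diff)
    then have "summable (\<lambda>n. M (Suc n) \<omega> - M n \<omega>)" by simp
    then have "convergent (\<lambda>n. \<Sum>k<n. M (Suc k) \<omega> - M k \<omega>)" by (simp only: summable_iff_convergent)
    then have "convergent (\<lambda>n. M n \<omega> - M 0 \<omega>)" by (simp only: sum_lessThan_telescope[of "\<lambda>n. M n \<omega>"])
    then have "convergent (\<lambda>n. (M n \<omega> - M 0 \<omega>) + M 0 \<omega>)" by (intro convergent_add convergent_const)
    then have lim: "(\<lambda>n. M n \<omega>) \<longlonglongrightarrow> Mlim \<omega>"
      unfolding Mlim_def by (simp add: convergent_LIMSEQ_iff)
    moreover have "0 \<le> Mlim \<omega>"
      by (rule LIMSEQ_le_const[OF lim]) (use level_unit[OF elim(1)] in \<open>auto simp: less_imp_le\<close>)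
    moreover have "Mlim \<omega> \<le> 1/27"
      by (rule LIMSEQ_le_const2[OF lim]) (use level_unit[OF elim(1)] in auto)
    ultimately show ?case using elim(1) by simp
  qed
qed

text \<open>
  Supermartingale bounds survive in the limit: if \<open>f\<close> dominates \<open>h (xyz)\<close>, up to a factor tending
  to 1, then \<open>f\<close> at time \<open>n\<close> bounds \<open>h (Mlim)\<close> in mean, for every nonnegative weight from
  the past of \<open>n\<close>.
\<close>
lemma limit_expectation:
  assumes f: "supermart f" and W: "past n W" "\<And>\<omega>. 0 \<le> W \<omega>"
    and h: "continuous_on {0..1/27} h" and [measurable]: "h \<in> borel_measurable borel"
    and hf: "\<And>a b c. 1 \<le> a \<Longrightarrow> 1 \<le> b \<Longrightarrow> 1 \<le> c \<Longrightarrow> h (level a b c) * (1 - r / (a+b+c)) \<le> f a b c"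
  shows "integrable P (\<lambda>\<omega>. W \<omega> * h (Mlim \<omega>))"
    and "expectation (\<lambda>\<omega>. W \<omega> * h (Mlim \<omega>)) \<le> expectation (\<lambda>\<omega>. W \<omega> * f (A n \<omega>) (B n \<omega>) (C n \<omega>))"
proof -
  have "compact (h ` {0..1/27})" using h by (intro compact_continuous_image) auto
  then obtain K where K: "\<And>m. m \<in> {0..1/27} \<Longrightarrow> \<bar>h m\<bar> \<le> K"
    using compact_imp_bounded bounded_iff by (metis imageI real_norm_def)
  define g where "g k \<omega> = W \<omega> * (h (M k \<omega>) * (1 - r / (T0 + 4 * real k)))" for k \<omega>
  have Wm [measurable]: "W \<in> borel_measurable P" using W(1) by (rule past_measurable)
  have gm: "g k \<in> borel_measurable P" for k unfolding g_def by measurable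
  have int: "integrable P (\<lambda>\<omega>. W \<omega> * (K * (1 + \<bar>r\<bar>)))"
    using past_integrable[OF W(1)] by simp
  have lim: "AE \<omega> in P. (\<lambda>k. g k \<omega>) \<longlonglongrightarrow> W \<omega> * (h (Mlim \<omega>) * (1 - 0))"
    using M_converges
  proof eventually_elim
    case (elim \<omega>)
    have "(\<lambda>k. h (M k \<omega>)) \<longlonglongrightarrow> h (Mlim \<omega>)"
      using elim level_unit[of \<omega>] by (intro continuous_on_tendsto_compose[OF h]) (auto simp: less_imp_le)
    moreover have "(\<lambda>k. r / (T0 + 4 * real k)) \<longlonglongrightarrow> 0" by real_asymp
    ultimately show ?case unfolding g_def by (intro tendsto_intros)
  qed
  have bd: "AE \<omega> in P. norm (g k \<omega>) \<le> W \<omega> * (K * (1 + \<bar>r\<bar>))" for k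
    using AE_regular
  proof eventually_elim
    case (elim \<omega>)
    have "\<bar>h (M k \<omega>)\<bar> \<le> K" using level_unit[OF elim, of k] by (intro K) auto
    moreover have "\<bar>r / (T0 + 4 * real k)\<bar> \<le> \<bar>r\<bar> / 1"
      unfolding abs_divide using T_gt[of k] by (intro frac_le) auto
    then have "\<bar>1 - r / (T0 + 4 * real k)\<bar> \<le> 1 + \<bar>r\<bar>" by linarith
    ultimately have "\<bar>h (M k \<omega>)\<bar> * \<bar>1 - r / (T0 + 4 * real k)\<bar> \<le> K * (1 + \<bar>r\<bar>)"
      by (intro mult_mono) auto
    then show ?case using W(2)[of \<omega>] by (simp add: g_def abs_mult mult_left_mono)
  qed
  have m: "(\<lambda>\<omega>. W \<omega> * (h (Mlim \<omega>) * (1 - 0))) \<in> borel_measurable P" by measurable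
  show "integrable P (\<lambda>\<omega>. W \<omega> * h (Mlim \<omega>))"
    using integrable_dominated_convergence[OF m gm int lim bd] by simp
  have "(\<lambda>k. expectation (g k)) \<longlonglongrightarrow> expectation (\<lambda>\<omega>. W \<omega> * h (Mlim \<omega>))"
    using integral_dominated_convergence[OF m gm int lim bd] by simp
  then show "expectation (\<lambda>\<omega>. W \<omega> * h (Mlim \<omega>)) \<le> expectation (\<lambda>\<omega>. W \<omega> * f (A n \<omega>) (B n \<omega>) (C n \<omega>))"
  proof (rule LIMSEQ_le_const2, intro exI allI impI)
    fix k assume k: "n \<le> k"
    have pk: "past k W" using past_mono[OF k W(1)] .
    have "expectation (g k) \<le> expectation (\<lambda>\<omega>. W \<omega> * f (A k \<omega>) (B k \<omega>) (C k \<omega>))"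
    proof (rule integral_mono_AE)
      show "integrable P (g k)"
        by (rule Bochner_Integration.integrable_bound[OF int gm])
          (use bd[of k] W(2) in \<open>auto elim!: eventually_mono intro: order_trans[OF _ abs_ge_self]\<close>)
      show "integrable P (\<lambda>\<omega>. W \<omega> * f (A k \<omega>) (B k \<omega>) (C k \<omega>))"
        by (rule past_integrable[OF past_comb[where f="(*)", OF pk past_state]])
      show "AE \<omega> in P. g k \<omega> \<le> W \<omega> * f (A k \<omega>) (B k \<omega>) (C k \<omega>)"
        using AE_regular
      proof eventually_elim
        case (elim \<omega>)
        show ?case unfolding g_def M_def
          using hf[OF regularD(1-3)[OF elim, of k]] regularD(4)[OF elim, of k] W(2)[of \<omega>]
          by (intro mult_left_mono) auto
      qed
    qed
    also have "\<dots> \<le> expectation (\<lambda>\<omega>. W \<omega> * f (A n \<omega>) (B n \<omega>) (C n \<omega>))"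
      by (rule supermart_expectation[OF f W k])
    finally show "expectation (g k) \<le> expectation (\<lambda>\<omega>. W \<omega> * f (A n \<omega>) (B n \<omega>) (C n \<omega>))" .
  qed
qed

section \<open>The limit lies strictly between its extreme values\<close>

lemma Mlim_pos: "AE \<omega> in P. 0 < Mlim \<omega>"
proof -
  define f where "f a b c = 4/a + 4/b + 4/c - ln (level a b c)" for a b c
  define V where "V = f (rocks G0) (papers G0) (scissors G0)"
  define E where "E = {\<omega> \<in> space P. Mlim \<omega> = 0}"
  have [measurable]: "E \<in> events" unfolding E_def by measurable
  have bound: "l * prob E \<le> V" if l: "0 < l" for l
  proof -
    \<comment> \<open>The function \<open>- ln\<close> truncated at \<open>l\<close>, which makes it bounded and continuous at 0.\<close>
    define h where "h m = - ln (max m (exp (-l)))" for m :: real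
    have h_le: "h m \<le> - ln m" if "0 < m" for m using that by (simp add: h_def)
    have cont: "continuous_on {0..1/27} h"
      unfolding h_def by (intro continuous_intros) (auto simp: max_def)
    have [measurable]: "h \<in> borel_measurable borel" unfolding h_def by measurable
    have hf: "h (level a b c) * (1 - 0 / (a+b+c)) \<le> f a b c" if "1 \<le> a" "1 \<le> b" "1 \<le> c" for a b c
    proof -
      have "0 \<le> 4/a + 4/b + 4/c" using that by (intro add_nonneg_nonneg) auto
      moreover have "h (level a b c) \<le> - ln (level a b c)"
        using that by (intro h_le level_bounds(1)) auto
      ultimately have "h (level a b c) \<le> f a b c" unfolding f_def by linarith
      then show ?thesis by simp
    qed
    have sf: "supermart f" using supermart_ln_level by (simp add: f_def[abs_def])
    note L = limit_expectation[OF sf past_const[of 0 1] _ cont _ hf]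
    have "expectation (\<lambda>\<omega>. 1 * h (Mlim \<omega>)) \<le> expectation (\<lambda>\<omega>. 1 * f (A 0 \<omega>) (B 0 \<omega>) (C 0 \<omega>))"
      by (rule L(2)) auto
    also have "\<dots> = expectation (\<lambda>\<omega>. V)"
    proof (rule integral_cong_AE)
      show "AE \<omega> in P. 1 * f (A 0 \<omega>) (B 0 \<omega>) (C 0 \<omega>) = V"
        using AE_regular by eventually_elim (simp add: V_def regular_def)
    qed (auto intro: past_measurable[OF past_state])
    also have "\<dots> = V" by (simp add: prob_space)
    finally have 1: "expectation (\<lambda>\<omega>. h (Mlim \<omega>)) \<le> V" by simp
    have int: "integrable P (\<lambda>\<omega>. h (Mlim \<omega>))" using L(1) by simp
    have "expectation (\<lambda>\<omega>. l * indicator E \<omega>) \<le> expectation (\<lambda>\<omega>. h (Mlim \<omega>))"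
    proof (rule integral_mono_AE[OF _ int])
      show "AE \<omega> in P. l * indicator E \<omega> \<le> h (Mlim \<omega>)"
        using M_converges
      proof eventually_elim
        case (elim \<omega>)
        have "max (Mlim \<omega>) (exp (-l)) \<le> 1" "0 < max (Mlim \<omega>) (exp (-l))"
          using elim l by (auto simp: less_max_iff_disj)
        then have "0 \<le> h (Mlim \<omega>)" unfolding h_def using ln_le_zero_iff by simp
        then show ?case by (auto simp: indicator_def E_def h_def)
      qed
    qed (auto intro!: integrable_mult_right integrable_real_indicator simp: emeasure_eq_measure)
    moreover have "expectation (\<lambda>\<omega>. l * indicator E \<omega>) = l * prob E" by simp
    ultimately show ?thesis using 1 by linarith
  qed
  have "prob E = 0"
  proof (rule ccontr)
    assume "prob E \<noteq> 0"
    then have p: "0 < prob E" using measure_nonneg[of P E] by linarith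
    define l where "l = (\<bar>V\<bar> + 1) / prob E"
    have "0 < l" "l * prob E = \<bar>V\<bar> + 1" using p by (auto simp: l_def)
    then show False using bound[of l] by linarith
  qed
  then have "AE \<omega> in P. \<omega> \<notin> E" using prob_eq_0[of E] by simp
  with M_converges AE_space show ?thesis
    by eventually_elim (auto simp: E_def less_le)
qed

text \<open>
  A second moment argument: given the past, \<open>1/27 - Mlim\<close> has mean at least \<open>s/27\<close> and second
  moment at most \<open>7001 s\<^sup>2\<close>, where \<open>s\<close> is the gap at time \<open>n\<close>. Dividing the weight by \<open>s\<close> and by
  \<open>s\<^sup>2\<close> gives these statements without conditioning.
\<close>
lemma escape_centre:
  assumes W: "past n W" "\<And>\<omega>. 0 \<le> W \<omega>"
  shows "expectation W / (729 * 7001) \<le> expectation (\<lambda>\<omega>. W \<omega> * of_bool (Mlim \<omega> \<noteq> 1/27))"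
proof -
  define s where "s \<omega> = gap (A n \<omega>) (B n \<omega>) (C n \<omega>)" for \<omega>
  \<comment> \<open>On the null set where \<open>s\<close> may fail to be positive, the maximum keeps the weights nonnegative.\<close>
  define s' where "s' \<omega> = max (s \<omega>) 0" for \<omega>
  have s': "regular \<omega> \<Longrightarrow> s' \<omega> = s \<omega>" and s_pos: "regular \<omega> \<Longrightarrow> 0 < s \<omega>" for \<omega>
    using gap_pos(1)[OF regularD(1-3)[of \<omega> n]] by (auto simp: s'_def s_def)
  have ps': "past n s'" unfolding s'_def s_def
    by (rule past_state[of n "\<lambda>a b c. max (gap a b c) 0"])
  define W1 where "W1 \<omega> = W \<omega> / s' \<omega>" for \<omega>
  define W2 where "W2 \<omega> = W \<omega> / (s' \<omega>)\<^sup>2" for \<omega>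
  have W1: "past n W1" "\<And>\<omega>. 0 \<le> W1 \<omega>" and W2: "past n W2" "\<And>\<omega>. 0 \<le> W2 \<omega>"
    unfolding W1_def[abs_def] W2_def[abs_def]
    using past_comb[OF W(1) ps', of "\<lambda>x y. x / y"] past_comb[OF W(1) ps', of "\<lambda>x y. x / y\<^sup>2"] W(2)
    by (auto simp: s'_def)
  have W12: "W1 \<omega> * s \<omega> = W \<omega>" "W2 \<omega> * (s \<omega>)\<^sup>2 = W \<omega>" if "regular \<omega>" for \<omega>
    using s'[OF that] s_pos[OF that] by (auto simp: W1_def W2_def)
  define D where "D \<omega> = 1/27 - Mlim \<omega>" for \<omega>
  have intW: "integrable P W" using W(1) by (rule past_integrable)
  have mW [measurable]: "W \<in> borel_measurable P" using W(1) by (rule past_measurable)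
  note L1 = limit_expectation[OF supermart_level W1, where h="\<lambda>m. m" and r=1]
  have int1: "integrable P (\<lambda>\<omega>. W1 \<omega> * Mlim \<omega>)" by (rule L1(1)) auto
  have intD: "integrable P (\<lambda>\<omega>. W1 \<omega> * D \<omega>)"
    unfolding D_def right_diff_distrib
    by (intro Bochner_Integration.integrable_diff int1 integrable_mult_left past_integrable[OF W1(1)])
  have first: "expectation W / 27 \<le> expectation (\<lambda>\<omega>. W1 \<omega> * D \<omega>)"
  proof -
    define q where "q \<omega> = level (A n \<omega>) (B n \<omega>) (C n \<omega>) * (1 - 1 / (A n \<omega> + B n \<omega> + C n \<omega>))" for \<omega>
    have pq: "past n q" unfolding q_def
      by (rule past_state[of n "\<lambda>a b c. level a b c * (1 - 1 / (a+b+c))"])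
    have i: "integrable P (\<lambda>\<omega>. W1 \<omega> * q \<omega>)"
      by (rule past_integrable[OF past_comb[where f="(*)", OF W1(1) pq]])
    have iw: "integrable P (\<lambda>\<omega>. W1 \<omega> * (1/27))" using past_integrable[OF W1(1)] by simp
    have "expectation W / 27 = expectation (\<lambda>\<omega>. W \<omega> / 27)" by simp
    also have "\<dots> \<le> expectation (\<lambda>\<omega>. W1 \<omega> * (1/27) - W1 \<omega> * q \<omega>)"
    proof (rule integral_mono_AE)
      show "AE \<omega> in P. W \<omega> / 27 \<le> W1 \<omega> * (1/27) - W1 \<omega> * q \<omega>"
        using AE_regular
      proof eventually_elim
        case (elim \<omega>)
        define t m where "t = A n \<omega> + B n \<omega> + C n \<omega>" and "m = level (A n \<omega>) (B n \<omega>) (C n \<omega>)"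
        have t: "3 \<le> t" using regularD(1-3)[OF elim, of n] by (simp add: t_def)
        have m: "m \<le> 1/27" using level_unit[OF elim, of n] by (simp add: m_def M_def)
        define r where "r = 1/t"
        have "r \<le> 1/3" unfolding r_def using t by (intro divide_left_mono) auto
        then have "(1/27 - m) * (1/27 + r) \<le> (1/27 - m) * 1"
          using m by (intro mult_left_mono) auto
        moreover have "1/27 - m * (1 - r) - (1/27 - m + r) / 27 = (1/27 - m) * 1 - (1/27 - m) * (1/27 + r)"
          by (simp add: field_simps)
        ultimately have "(1/27 - m + r) / 27 \<le> 1/27 - m * (1 - r)" by linarith
        then have "(1/27 - m + 1/t) / 27 \<le> 1/27 - m * (1 - 1/t)" by (simp add: r_def)
        then have "s \<omega> / 27 \<le> 1/27 - q \<omega>"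
          by (simp add: s_def gap_def q_def t_def m_def)
        then have "W1 \<omega> * (s \<omega> / 27) \<le> W1 \<omega> * (1/27 - q \<omega>)" using W1(2) by (rule mult_left_mono)
        then show ?case using W12(1)[OF elim] by (simp add: right_diff_distrib)
      qed
    qed (use intW i iw in auto)
    also have "\<dots> = expectation (\<lambda>\<omega>. W1 \<omega> * (1/27)) - expectation (\<lambda>\<omega>. W1 \<omega> * q \<omega>)"
      by (rule Bochner_Integration.integral_diff[OF iw i])
    also have "\<dots> \<le> expectation (\<lambda>\<omega>. W1 \<omega> * (1/27)) - expectation (\<lambda>\<omega>. W1 \<omega> * Mlim \<omega>)"
      unfolding q_def using L1(2) by simp
    also have "\<dots> = expectation (\<lambda>\<omega>. W1 \<omega> * (1/27) - W1 \<omega> * Mlim \<omega>)"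
      by (rule Bochner_Integration.integral_diff[OF iw int1, symmetric])
    finally show ?thesis by (simp add: D_def right_diff_distrib)
  qed
  have hf: "(1/27 - level a b c)\<^sup>2 * (1 - 0/(a+b+c)) \<le> (gap a b c)\<^sup>2 + 7000 * gap a b c / (a+b+c)"
    if abc: "1 \<le> a" "1 \<le> b" "1 \<le> c" for a b c
  proof -
    note g = gap_pos[OF abc]
    have "(1/27 - level a b c)\<^sup>2 \<le> (gap a b c)\<^sup>2"
      using g level_bounds[of a b c] abc by (intro power_mono) (auto simp: gap_def)
    moreover have "0 \<le> 7000 * gap a b c / (a+b+c)"
      using g(1) abc by (intro divide_nonneg_nonneg) auto
    ultimately show ?thesis by simp
  qed
  note L2 = limit_expectation[OF supermart_gap_square W2, where h="\<lambda>m. (1/27 - m)\<^sup>2" and r=0, OF _ _ hf]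
  have intD2: "integrable P (\<lambda>\<omega>. W2 \<omega> * (D \<omega>)\<^sup>2)"
    unfolding D_def by (rule L2(1)) (auto intro!: continuous_intros)
  have "expectation (\<lambda>\<omega>. W2 \<omega> * (D \<omega>)\<^sup>2)
      \<le> expectation (\<lambda>\<omega>. W2 \<omega> * ((gap (A n \<omega>) (B n \<omega>) (C n \<omega>))\<^sup>2 + 7000 * gap (A n \<omega>) (B n \<omega>) (C n \<omega>) / (A n \<omega> + B n \<omega> + C n \<omega>)))"
    unfolding D_def by (rule L2(2)) (auto intro!: continuous_intros)
  also have "\<dots> \<le> expectation (\<lambda>\<omega>. 7001 * W \<omega>)"
  proof (rule integral_mono_AE)
    show "integrable P (\<lambda>\<omega>. W2 \<omega> * ((gap (A n \<omega>) (B n \<omega>) (C n \<omega>))\<^sup>2 + 7000 * gap (A n \<omega>) (B n \<omega>) (C n \<omega>) / (A n \<omega> + B n \<omega> + C n \<omega>)))"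
      by (rule past_integrable[OF past_comb[where f="(*)", OF W2(1)
        past_state[of n "\<lambda>a b c. (gap a b c)\<^sup>2 + 7000 * gap a b c / (a+b+c)"]]])
    show "AE \<omega> in P. W2 \<omega> * ((gap (A n \<omega>) (B n \<omega>) (C n \<omega>))\<^sup>2 + 7000 * gap (A n \<omega>) (B n \<omega>) (C n \<omega>) / (A n \<omega> + B n \<omega> + C n \<omega>)) \<le> 7001 * W \<omega>"
      using AE_regular
    proof eventually_elim
      case (elim \<omega>)
      have "7000 * s \<omega> * (1 / (A n \<omega> + B n \<omega> + C n \<omega>)) \<le> 7000 * s \<omega> * s \<omega>"
        using gap_pos(3)[OF regularD(1)[OF elim, of n] regularD(2)[OF elim, of n] regularD(3)[OF elim, of n]]
          s_pos[OF elim] by (intro mult_left_mono) (auto simp: s_def)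
      then have "(s \<omega>)\<^sup>2 + 7000 * s \<omega> / (A n \<omega> + B n \<omega> + C n \<omega>) \<le> 7001 * (s \<omega>)\<^sup>2"
        by (simp add: power2_eq_square)
      then have "W2 \<omega> * ((s \<omega>)\<^sup>2 + 7000 * s \<omega> / (A n \<omega> + B n \<omega> + C n \<omega>)) \<le> W2 \<omega> * (7001 * (s \<omega>)\<^sup>2)"
        using W2(2) by (rule mult_left_mono)
      also have "\<dots> = 7001 * W \<omega>" using W12(2)[OF elim] by (simp add: mult.left_commute)
      finally show ?case by (simp add: s_def)
    qed
  qed (use intW in auto)
  finally have second: "expectation (\<lambda>\<omega>. W2 \<omega> * (D \<omega>)\<^sup>2) \<le> 7001 * expectation W" by simp
  \<comment> \<open>With \<open>u = D/s\<close>, the bound \<open>u \<le> l u\<^sup>2 + 1/(4 l)\<close> for \<open>u \<noteq> 0\<close> replaces the Cauchy-Schwarz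
    inequality; this \<open>l\<close> makes the quadratic term use up half of the mean.\<close>
  define l :: real where "l = 1 / (54 * 7001)"
  have int3: "integrable P (\<lambda>\<omega>. W \<omega> * of_bool (Mlim \<omega> \<noteq> 1/27))"
    by (rule Bochner_Integration.integrable_bound[OF intW]) auto
  have "expectation (\<lambda>\<omega>. W1 \<omega> * D \<omega>)
      \<le> expectation (\<lambda>\<omega>. l * (W2 \<omega> * (D \<omega>)\<^sup>2) + 1/(4*l) * (W \<omega> * of_bool (Mlim \<omega> \<noteq> 1/27)))"
  proof (rule integral_mono_AE)
    show "AE \<omega> in P. W1 \<omega> * D \<omega> \<le> l * (W2 \<omega> * (D \<omega>)\<^sup>2) + 1/(4*l) * (W \<omega> * of_bool (Mlim \<omega> \<noteq> 1/27))"
      using AE_regular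
    proof eventually_elim
      case (elim \<omega>)
      define u where "u = D \<omega> / s \<omega>"
      have "W1 \<omega> * D \<omega> = W \<omega> * u" "W2 \<omega> * (D \<omega>)\<^sup>2 = W \<omega> * u\<^sup>2"
        using s'[OF elim] by (auto simp: W1_def W2_def u_def power_divide)
      moreover have "u \<le> l * u\<^sup>2 + 1/(4*l) * of_bool (Mlim \<omega> \<noteq> 1/27)"
      proof (cases "Mlim \<omega> = 1/27")
        case False
        have "0 \<le> l * (u - 1/(2*l))\<^sup>2" by (simp add: l_def)
        also have "\<dots> = l * u\<^sup>2 + 1/(4*l) - u" by (simp add: power2_eq_square l_def field_simps)
        finally show ?thesis using False by simp
      next
        case True
        then have "D \<omega> = 0" by (simp add: D_def)
        then show ?thesis using True by (simp add: u_def)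
      qed
      then have "W \<omega> * u \<le> W \<omega> * (l * u\<^sup>2 + 1/(4*l) * of_bool (Mlim \<omega> \<noteq> 1/27))"
        using W(2) by (rule mult_left_mono)
      ultimately show ?case by (simp add: algebra_simps)
    qed
  qed (use intD intD2 int3 in auto)
  also have "\<dots> = l * expectation (\<lambda>\<omega>. W2 \<omega> * (D \<omega>)\<^sup>2) + 1/(4*l) * expectation (\<lambda>\<omega>. W \<omega> * of_bool (Mlim \<omega> \<noteq> 1/27))"
    using intD2 int3 by simp
  also have "\<dots> \<le> l * (7001 * expectation W) + 1/(4*l) * expectation (\<lambda>\<omega>. W \<omega> * of_bool (Mlim \<omega> \<noteq> 1/27))"
    using second by (intro add_right_mono mult_left_mono) (auto simp: l_def)
  finally show ?thesis using first by (simp add: l_def)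
qed

text \<open>
  Applying \<open>escape_centre\<close> to weights \<open>w k (M n)\<close> that concentrate where \<open>M n\<close> is close to \<open>1/27\<close>,
  and letting first \<open>n\<close> and then \<open>k\<close> tend to infinity, bounds a multiple of the probability of
  \<open>Mlim = 1/27\<close> by that of the impossible event \<open>Mlim = 1/27 \<and> Mlim \<noteq> 1/27\<close>.
\<close>
lemma Mlim_less: "AE \<omega> in P. Mlim \<omega> < 1/27"
proof -
  define E where "E = {\<omega> \<in> space P. Mlim \<omega> = 1/27}"
  have [measurable]: "E \<in> events" unfolding E_def by measurable
  define c :: real where "c = 1 / (729 * 7001)"
  define w where "w k m = 1 / (1 + real k * \<bar>1/27 - m\<bar>)" for k and m :: real
  have w01: "0 \<le> w k m" "w k m \<le> 1" for k m
  proof -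
    have "0 \<le> real k * \<bar>1/27 - m\<bar>" by simp
    then show "0 \<le> w k m" "w k m \<le> 1" unfolding w_def by (simp_all add: divide_le_eq)
  qed
  have wc: "isCont (w k) m" for k m
    unfolding w_def by (intro continuous_intros) (metis abs_ge_zero add_nonneg_pos add.commute mult_nonneg_nonneg of_nat_0_le_iff order_less_irrefl zero_less_one)
  have [measurable]: "w k \<in> borel_measurable borel" for k unfolding w_def by measurable
  have step1: "c * expectation (\<lambda>\<omega>. w k (Mlim \<omega>)) \<le> expectation (\<lambda>\<omega>. w k (Mlim \<omega>) * of_bool (Mlim \<omega> \<noteq> 1/27))" for k
  proof -
    have lim: "AE \<omega> in P. (\<lambda>n. w k (M n \<omega>)) \<longlonglongrightarrow> w k (Mlim \<omega>)"
      using M_converges by eventually_elim (auto intro: isCont_tendsto_compose[OF wc])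
    have "(\<lambda>n. expectation (\<lambda>\<omega>. w k (M n \<omega>))) \<longlonglongrightarrow> expectation (\<lambda>\<omega>. w k (Mlim \<omega>))"
      by (rule integral_dominated_convergence[where w="\<lambda>_. 1"]) (use lim w01 in auto)
    moreover have "(\<lambda>n. expectation (\<lambda>\<omega>. w k (M n \<omega>) * of_bool (Mlim \<omega> \<noteq> 1/27)))
        \<longlonglongrightarrow> expectation (\<lambda>\<omega>. w k (Mlim \<omega>) * of_bool (Mlim \<omega> \<noteq> 1/27))"
      by (rule integral_dominated_convergence[where w="\<lambda>_. 1"])
         (use lim w01 in \<open>auto elim!: eventually_mono intro!: tendsto_mult simp: abs_mult mult_le_one\<close>)
    moreover have "c * expectation (\<lambda>\<omega>. w k (M n \<omega>)) \<le> expectation (\<lambda>\<omega>. w k (M n \<omega>) * of_bool (Mlim \<omega> \<noteq> 1/27))" for n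
      using escape_centre[of n "\<lambda>\<omega>. w k (M n \<omega>)"] past_state[of n "\<lambda>a b c. w k (level a b c)"] w01
      by (simp add: M_def c_def)
    ultimately show ?thesis
      by (intro LIMSEQ_le[OF tendsto_mult_left]) auto
  qed
  have wlim: "(\<lambda>k. w k m) \<longlonglongrightarrow> of_bool (m = 1/27)" for m
  proof (cases "m = 1/27")
    case False
    then have "0 < \<bar>1/27 - m\<bar>" by simp
    then have "(\<lambda>k. w k m) \<longlonglongrightarrow> 0" unfolding w_def by real_asymp
    then show ?thesis using False by simp
  next
    case True
    show ?thesis unfolding True by (simp add: w_def)
  qed
  have "(\<lambda>k. expectation (\<lambda>\<omega>. w k (Mlim \<omega>))) \<longlonglongrightarrow> expectation (\<lambda>\<omega>. of_bool (Mlim \<omega> = 1/27))"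
  proof (rule integral_dominated_convergence[where w="\<lambda>_. 1"])
    show "AE \<omega> in P. (\<lambda>k. w k (Mlim \<omega>)) \<longlonglongrightarrow> of_bool (Mlim \<omega> = 1/27)"
      by (intro AE_I2 wlim)
  qed (use w01 in auto)
  moreover have "(\<lambda>k. expectation (\<lambda>\<omega>. w k (Mlim \<omega>) * of_bool (Mlim \<omega> \<noteq> 1/27)))
      \<longlonglongrightarrow> expectation (\<lambda>\<omega>. of_bool (Mlim \<omega> = 1/27) * of_bool (Mlim \<omega> \<noteq> 1/27))"
  proof (rule integral_dominated_convergence[where w="\<lambda>_. 1"])
    show "AE \<omega> in P. (\<lambda>k. w k (Mlim \<omega>) * of_bool (Mlim \<omega> \<noteq> 1/27))
        \<longlonglongrightarrow> of_bool (Mlim \<omega> = 1/27) * of_bool (Mlim \<omega> \<noteq> 1/27)"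
      by (intro AE_I2 tendsto_mult wlim tendsto_const)
  qed (use w01 in \<open>auto simp: abs_mult mult_le_one\<close>)
  ultimately have "c * expectation (\<lambda>\<omega>. of_bool (Mlim \<omega> = 1/27)) \<le> expectation (\<lambda>\<omega>. of_bool (Mlim \<omega> = 1/27) * of_bool (Mlim \<omega> \<noteq> 1/27))"
    using step1 by (intro LIMSEQ_le[OF tendsto_mult_left]) auto
  also have "\<dots> = expectation (\<lambda>\<omega>. 0)" by (intro Bochner_Integration.integral_cong) auto
  also have "expectation (\<lambda>\<omega>. of_bool (Mlim \<omega> = 1/27)) = expectation (indicator E)"
    by (intro Bochner_Integration.integral_cong) (auto simp: E_def)
  finally have "prob E \<le> 0" by (simp add: c_def)
  then have "prob E = 0" using measure_nonneg[of P E] by linarith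
  then have "AE \<omega> in P. \<omega> \<notin> E" using prob_eq_0[of E] by simp
  with M_converges AE_space show ?thesis
    by eventually_elim (auto simp: E_def less_le)
qed

section \<open>Full support of the limit\<close>

text \<open>
  The indicator of a given state at time \<open>n\<close>.
\<close>
definition at_state :: "nat \<Rightarrow> real \<Rightarrow> real \<Rightarrow> real \<Rightarrow> 'w \<Rightarrow> real" where
  "at_state n a b c \<omega> = of_bool (A n \<omega> = a \<and> B n \<omega> = b \<and> C n \<omega> = c)"

lemma past_at_state: "past n (at_state n a b c)"
  unfolding at_state_def[abs_def]
  by (rule past_state[of n "\<lambda>a' b' c'. of_bool (a' = a \<and> b' = b \<and> c' = c)"])

text \<open>
  The moves in which a single type is chosen twice.
\<close>
lemma reach_step:
  assumes pos: "1 \<le> a" "1 \<le> b" "1 \<le> c" and p: "0 < expectation (at_state n a b c)"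
    and ijk: "(i, j, k) \<in> {(4,0,0), (0,4,0), (0,0,4)}"
  shows "0 < expectation (at_state (Suc n) (a+i) (b+j) (c+k))"
proof -
  define f where "f a' b' c' = (of_bool (a' = a+i \<and> b' = b+j \<and> c' = c+k) :: real)" for a' b' c'
  define r where "r = (min a (min b c))\<^sup>2 / (a+b+c)\<^sup>2"
  have r: "0 < r" using pos by (auto simp: r_def min_def)
  have avg_ge: "r \<le> avg a b c (\<lambda>i j k. f (a+i) (b+j) (c+k))"
  proof -
    have "(min a (min b c))\<^sup>2 \<le> a\<^sup>2" "(min a (min b c))\<^sup>2 \<le> b\<^sup>2" "(min a (min b c))\<^sup>2 \<le> c\<^sup>2"
      using pos by (auto intro!: power_mono)
    then show ?thesis unfolding r_def avg_def f_def
      using ijk pos by (intro divide_right_mono) auto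
  qed
  have "r * expectation (at_state n a b c) = expectation (\<lambda>\<omega>. r * at_state n a b c \<omega>)" by simp
  also have "\<dots> \<le> expectation (\<lambda>\<omega>. 1 * avg (A n \<omega>) (B n \<omega>) (C n \<omega>) (\<lambda>i j k. f (A n \<omega> + i) (B n \<omega> + j) (C n \<omega> + k)))"
  proof (rule integral_mono_AE)
    show "integrable P (\<lambda>\<omega>. r * at_state n a b c \<omega>)" using past_integrable[OF past_at_state] by simp
    show "integrable P (\<lambda>\<omega>. 1 * avg (A n \<omega>) (B n \<omega>) (C n \<omega>) (\<lambda>i j k. f (A n \<omega> + i) (B n \<omega> + j) (C n \<omega> + k)))"
      using past_integrable[OF past_state[of n "\<lambda>a b c. avg a b c (\<lambda>i j k. f (a+i) (b+j) (c+k))"]] by simp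
    show "AE \<omega> in P. r * at_state n a b c \<omega>
       \<le> 1 * avg (A n \<omega>) (B n \<omega>) (C n \<omega>) (\<lambda>i j k. f (A n \<omega> + i) (B n \<omega> + j) (C n \<omega> + k))"
      using AE_regular
    proof eventually_elim
      case (elim \<omega>)
      show ?case
      proof (cases "A n \<omega> = a \<and> B n \<omega> = b \<and> C n \<omega> = c")
        case True
        then show ?thesis using avg_ge by (simp add: at_state_def)
      next
        case False
        then show ?thesis using regularD(1-3)[OF elim, of n] by (auto simp: at_state_def avg_def f_def)
      qed
    qed
  qed
  also have "\<dots> = expectation (\<lambda>\<omega>. 1 * f (A (Suc n) \<omega>) (B (Suc n) \<omega>) (C (Suc n) \<omega>))"
    by (rule markov[OF past_const[of n 1], symmetric])
  also have "\<dots> = expectation (at_state (Suc n) (a+i) (b+j) (c+k))"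
    by (simp add: f_def at_state_def[abs_def])
  finally show ?thesis using mult_pos_pos[OF r p] by linarith
qed

abbreviation "a0 \<equiv> rocks G0"
abbreviation "b0 \<equiv> papers G0"
abbreviation "c0 \<equiv> scissors G0"

lemma reach: "0 < expectation (at_state (i + j + k) (a0 + 4 * real i) (b0 + 4 * real j) (c0 + 4 * real k))"
proof -
  have g: "1 \<le> a0" "1 \<le> b0" "1 \<le> c0" using good0 by (auto simp: good_def)
  have 0: "0 < expectation (at_state 0 a0 b0 c0)"
  proof -
    have "expectation (at_state 0 a0 b0 c0) = expectation (\<lambda>\<omega>. 1)"
    proof (rule integral_cong_AE)
      show "AE \<omega> in P. at_state 0 a0 b0 c0 \<omega> = 1"
        using AE_regular by eventually_elim (simp add: at_state_def regular_def)
    qed (use past_measurable[OF past_at_state] in auto)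
    then show ?thesis by (simp add: prob_space)
  qed
  have 1: "0 < expectation (at_state i (a0 + 4 * real i) b0 c0)" for i
  proof (induction i)
    case (Suc i)
    then show ?case using reach_step[of "a0 + 4 * real i" b0 c0 i 4 0 0] g by (simp add: algebra_simps)
  qed (use 0 in simp)
  have 2: "0 < expectation (at_state (i + j) (a0 + 4 * real i) (b0 + 4 * real j) c0)" for i j
  proof (induction j)
    case (Suc j)
    then show ?case using reach_step[of "a0 + 4 * real i" "b0 + 4 * real j" c0 "i + j" 0 4 0] g by (simp add: algebra_simps)
  qed (use 1 in simp)
  show ?thesis
  proof (induction k)
    case (Suc k)
    then show ?case using reach_step[of "a0 + 4 * real i" "b0 + 4 * real j" "c0 + 4 * real k" "i + j + k" 0 0 4] g
      by (simp add: algebra_simps)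
  qed (use 2 in simp)
qed

lemma reach_level:
  assumes \<mu>: "0 < \<mu>" "\<mu> < 1/27" and e: "0 < e"
  obtains n a b c where "1 \<le> a" "1 \<le> b" "1 \<le> c" "0 < expectation (at_state n a b c)"
    "(level a b c - \<mu>)\<^sup>2 + 200 / (a+b+c) < e"
proof -
  obtain x y z :: real where xyz: "0 < x" "0 < y" "0 < z" "x + y + z = 1" "x * y * z = \<mu>"
    using level_curve_point[OF \<mu>] .
  \<comment> \<open>About \<open>x n\<close>, \<open>y n\<close>, \<open>z n\<close> pure moves of the three types lead to shares close to \<open>x\<close>, \<open>y\<close>, \<open>z\<close>.\<close>
  define f where "f u n = real (nat \<lfloor>u * real n\<rfloor>)" for u :: real and n :: nat
  have lim: "(\<lambda>n. (r + 4 * f u n) / real n) \<longlonglongrightarrow> 4 * u" if "0 < u" for u r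
  proof -
    have "(\<lambda>n. (r + 4 * real_of_int \<lfloor>u * real n\<rfloor>) / real n) \<longlonglongrightarrow> 4 * u"
      using that by real_asymp
    moreover have "f u n = real_of_int \<lfloor>u * real n\<rfloor>" for n
      using that by (simp add: f_def)
    ultimately show ?thesis by simp
  qed
  define a b c where "a n = a0 + 4 * f x n" and "b n = b0 + 4 * f y n" and "c n = c0 + 4 * f z n" for n
  have g: "1 \<le> a0" "1 \<le> b0" "1 \<le> c0" using good0 by (auto simp: good_def)
  then have ge1: "1 \<le> a n" "1 \<le> b n" "1 \<le> c n" for n by (auto simp: a_def b_def c_def f_def)
  have la: "(\<lambda>n. a n / real n) \<longlonglongrightarrow> 4 * x" and lb: "(\<lambda>n. b n / real n) \<longlonglongrightarrow> 4 * y"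
    and lc: "(\<lambda>n. c n / real n) \<longlonglongrightarrow> 4 * z"
    using lim xyz by (auto simp: a_def b_def c_def)
  have lt: "(\<lambda>n. a n / real n + b n / real n + c n / real n) \<longlonglongrightarrow> 4"
  proof -
    have "4 * x + 4 * y + 4 * z = 4" using xyz(4) by linarith
    then show ?thesis using tendsto_add[OF tendsto_add[OF la lb] lc] by simp
  qed
  have "(\<lambda>n. (level (a n / real n) (b n / real n) (c n / real n) - \<mu>)\<^sup>2
      + 200 * (1 / real n) / (a n / real n + b n / real n + c n / real n))
      \<longlonglongrightarrow> ((4*x) * (4*y) * (4*z) / 4^3 - \<mu>)\<^sup>2 + 200 * 0 / 4"
    unfolding level_def by (intro tendsto_intros la lb lc lt lim_1_over_n) auto
  also have "((4*x) * (4*y) * (4*z) / 4^3 - \<mu>)\<^sup>2 + 200 * 0 / 4 = 0" using xyz(5) by simp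
  finally have "eventually (\<lambda>n. (level (a n / real n) (b n / real n) (c n / real n) - \<mu>)\<^sup>2
      + 200 * (1 / real n) / (a n / real n + b n / real n + c n / real n) < e) sequentially"
    using e by (rule order_tendstoD)
  with eventually_gt_at_top[of 0] have "eventually (\<lambda>n. (level (a n) (b n) (c n) - \<mu>)\<^sup>2 + 200 / (a n + b n + c n) < e) sequentially"
  proof eventually_elim
    case (elim n)
    have "level (a n / real n) (b n / real n) (c n / real n) = level (a n) (b n) (c n)"
      using elim(1) by (simp add: level_shares add_divide_distrib[symmetric])
    moreover have "200 * (1 / real n) / (a n / real n + b n / real n + c n / real n) = 200 / (a n + b n + c n)"
      using elim(1) by (simp add: add_divide_distrib[symmetric])
    ultimately show ?case using elim(2) by simp
  qed
  then obtain n where "(level (a n) (b n) (c n) - \<mu>)\<^sup>2 + 200 / (a n + b n + c n) < e"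
    by (auto simp: eventually_sequentially)
  moreover have "0 < expectation (at_state (nat \<lfloor>x * real n\<rfloor> + nat \<lfloor>y * real n\<rfloor> + nat \<lfloor>z * real n\<rfloor>) (a n) (b n) (c n))"
    unfolding a_def b_def c_def f_def by (rule reach)
  ultimately show ?thesis by (intro that[OF ge1])
qed

lemma Mlim_full_support:
  assumes I: "open I" "I \<noteq> {}" "I \<subseteq> {0<..<1/27}"
  shows "0 < measure (distr P borel Mlim) I"
proof -
  obtain \<mu> where \<mu>: "\<mu> \<in> I" using I(2) by blast
  then have \<mu>01: "0 < \<mu>" "\<mu> < 1/27" using I(3) by auto
  obtain e where e: "0 < e" "ball \<mu> e \<subseteq> I" using I(1) \<mu> by (auto simp: open_contains_ball)
  obtain n a b c where abc: "1 \<le> a" "1 \<le> b" "1 \<le> c" "0 < expectation (at_state n a b c)"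
      "(level a b c - \<mu>)\<^sup>2 + 200 / (a+b+c) < e\<^sup>2"
    by (rule reach_level[OF \<mu>01, of "e\<^sup>2"]) (use e in simp)
  define W where "W = at_state n a b c"
  have W: "past n W" "\<And>\<omega>. 0 \<le> W \<omega>" "0 < expectation W"
    using past_at_state abc(4) by (auto simp: W_def at_state_def)
  have intW: "integrable P W" using W(1) by (rule past_integrable)
  define E where "E = {\<omega> \<in> space P. Mlim \<omega> \<in> I}"
  have Im [measurable]: "I \<in> sets borel" using I(1) by simp
  have [measurable]: "E \<in> events" unfolding E_def by measurable
  have "prob E \<noteq> 0"
  proof
    assume "prob E = 0"
    then have ae: "AE \<omega> in P. \<omega> \<notin> E" using prob_eq_0[of E] by simp
    define f where "f a b c = (level a b c - \<mu>)\<^sup>2 + 200 / (a+b+c)" for a b c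
    have sf: "supermart f" using supermart_level_square[of \<mu>] \<mu>01 by (simp add: f_def[abs_def])
    have hf: "(level a b c - \<mu>)\<^sup>2 * (1 - 0/(a+b+c)) \<le> f a b c" if "1 \<le> a" "1 \<le> b" "1 \<le> c" for a b c
      using that by (simp add: f_def)
    note L = limit_expectation[OF sf W(1,2), where h="\<lambda>m. (m - \<mu>)\<^sup>2" and r=0, OF _ _ hf]
    have "e\<^sup>2 * expectation W = expectation (\<lambda>\<omega>. W \<omega> * e\<^sup>2)" by simp
    also have "\<dots> \<le> expectation (\<lambda>\<omega>. W \<omega> * (Mlim \<omega> - \<mu>)\<^sup>2)"
    proof (rule integral_mono_AE)
      show "integrable P (\<lambda>\<omega>. W \<omega> * (Mlim \<omega> - \<mu>)\<^sup>2)" by (rule L(1)) (auto intro!: continuous_intros)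
      show "AE \<omega> in P. W \<omega> * e\<^sup>2 \<le> W \<omega> * (Mlim \<omega> - \<mu>)\<^sup>2"
        using ae AE_space
      proof eventually_elim
        case (elim \<omega>)
        then have "Mlim \<omega> \<notin> ball \<mu> e" using e by (auto simp: E_def)
        then have "e \<le> \<bar>Mlim \<omega> - \<mu>\<bar>" by (simp add: dist_real_def)
        then have "e\<^sup>2 \<le> \<bar>Mlim \<omega> - \<mu>\<bar>\<^sup>2" using e by (intro power_mono) auto
        then show ?case using W(2) by (intro mult_left_mono) auto
      qed
    qed (use intW in auto)
    also have "\<dots> \<le> expectation (\<lambda>\<omega>. W \<omega> * f (A n \<omega>) (B n \<omega>) (C n \<omega>))"
      by (rule L(2)) (auto intro!: continuous_intros)
    also have "\<dots> = expectation (\<lambda>\<omega>. W \<omega> * f a b c)"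
      by (intro Bochner_Integration.integral_cong) (auto simp: W_def at_state_def)
    also have "\<dots> = expectation W * f a b c" by simp
    finally have "e\<^sup>2 * expectation W \<le> f a b c * expectation W" by (simp add: mult.commute)
    then show False using abc(5) W(3) by (simp add: f_def)
  qed
  then have "0 < prob E" using measure_nonneg[of P E] by linarith
  moreover have "measure (distr P borel Mlim) I = prob E"
    by (subst measure_distr) (auto simp: E_def intro!: arg_cong[where f="measure P"])
  ultimately show ?thesis by simp
qed

section \<open>The limit set of the shares\<close>

lemma shares_eq:
  "share g Rock = rocks g / (rocks g + papers g + scissors g)"
  "share g Paper = papers g / (rocks g + papers g + scissors g)"
  "share g Scissors = scissors g / (rocks g + papers g + scissors g)"
  by (simp_all add: share_def total_degree_real flip: rocks_def papers_def scissors_def)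

lemma limit_set_shares: "AE \<omega> in P. limit_set (\<lambda>n. shares (G n \<omega>)) = level_curve (Mlim \<omega>)"
proof -
  have nx: "AE \<omega> in P. summable (\<lambda>n. A (Suc n) \<omega> / (A (Suc n) \<omega> + B (Suc n) \<omega> + C (Suc n) \<omega>)
     - avg (A n \<omega>) (B n \<omega>) (C n \<omega>) (\<lambda>i j k. (A n \<omega> + i) / ((A n \<omega> + i) + (B n \<omega> + j) + (C n \<omega> + k))))"
    by (rule noise_summable[where u="\<lambda>a b c. a / (a+b+c)" and K=4]) (auto intro!: share_step_le)
  have ny: "AE \<omega> in P. summable (\<lambda>n. B (Suc n) \<omega> / (A (Suc n) \<omega> + B (Suc n) \<omega> + C (Suc n) \<omega>)
     - avg (A n \<omega>) (B n \<omega>) (C n \<omega>) (\<lambda>i j k. (B n \<omega> + j) / ((A n \<omega> + i) + (B n \<omega> + j) + (C n \<omega> + k))))"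
  proof (rule noise_summable[where u="\<lambda>a b c. b / (a+b+c)" and K=4])
    fix a b c i j k :: real assume *: "1 \<le> a" "1 \<le> b" "1 \<le> c" "move i j k"
    have "move j k i" using *(4) by (auto simp: move_def)
    then show "\<bar>(b+j) / ((a+i)+(b+j)+(c+k)) - b/(a+b+c)\<bar> \<le> 4 / (a+b+c)"
      using share_step_le[of b c a j k i] * by (simp add: add_ac)
  qed
  show ?thesis
    using M_converges Mlim_pos Mlim_less nx ny
  proof eventually_elim
    case (elim \<omega>)
    define x y z where "x n = share (G n \<omega>) Rock" and "y n = share (G n \<omega>) Paper" and "z n = share (G n \<omega>) Scissors" for n
    note R = regularD[OF conjunct1[OF elim(1)]]
    have "limit_set (\<lambda>n. (x n, y n, z n)) = level_curve (Mlim \<omega>)"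
    proof (rule limit_set_rotation)
      show "0 < T0 + 4" using T0_ge by simp
      fix n
      have g: "0 < A n \<omega>" "0 < B n \<omega>" "0 < C n \<omega>" using R(1-3)[of n] by auto
      show "0 \<le> x n" "0 \<le> y n" "0 \<le> z n" using g by (auto simp: x_def y_def z_def shares_eq)
      show "x n + y n + z n = 1" using g by (simp add: x_def y_def z_def shares_eq add_divide_distrib[symmetric])
    next
      show "0 < Mlim \<omega>" "Mlim \<omega> < 1/27" using elim by auto
      show "(\<lambda>n. x n * y n * z n) \<longlonglongrightarrow> Mlim \<omega>"
        using elim(1) by (simp add: x_def y_def z_def shares_eq M_def level_shares)
      have eqx: "x (Suc n) - x n - 2 * x n * (z n - y n) / (T0 + 4 + 4 * real n)
          = A (Suc n) \<omega> / (A (Suc n) \<omega> + B (Suc n) \<omega> + C (Suc n) \<omega>)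
           - avg (A n \<omega>) (B n \<omega>) (C n \<omega>) (\<lambda>i j k. (A n \<omega> + i) / ((A n \<omega> + i) + (B n \<omega> + j) + (C n \<omega> + k)))" for n
        using avg_share[of "A n \<omega>" "B n \<omega>" "C n \<omega>"] R(1-3)[of n]
        unfolding x_def y_def z_def shares_eq R(4)[of n] by (simp add: add_ac)
      show "summable (\<lambda>n. x (Suc n) - x n - 2 * x n * (z n - y n) / (T0 + 4 + 4 * real n))"
        unfolding eqx using elim by simp
      have eqy: "y (Suc n) - y n - 2 * y n * (x n - z n) / (T0 + 4 + 4 * real n)
          = B (Suc n) \<omega> / (A (Suc n) \<omega> + B (Suc n) \<omega> + C (Suc n) \<omega>)
           - avg (A n \<omega>) (B n \<omega>) (C n \<omega>) (\<lambda>i j k. (B n \<omega> + j) / ((A n \<omega> + i) + (B n \<omega> + j) + (C n \<omega> + k)))" for n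
      proof -
        have "avg (A n \<omega>) (B n \<omega>) (C n \<omega>) (\<lambda>i j k. (B n \<omega> + j) / ((A n \<omega> + i) + (B n \<omega> + j) + (C n \<omega> + k)))
          = avg (B n \<omega>) (C n \<omega>) (A n \<omega>) (\<lambda>j k i. (B n \<omega> + j) / ((B n \<omega> + j) + (C n \<omega> + k) + (A n \<omega> + i)))"
          unfolding avg_rot[of "A n \<omega>"] by (simp add: add_ac)
        moreover have "B n \<omega> + C n \<omega> + A n \<omega> = T0 + 4 * real n" using R(4)[of n] by simp
        ultimately show ?thesis
          using avg_share[of "B n \<omega>" "C n \<omega>" "A n \<omega>"] R(1-3)[of n]
          unfolding x_def y_def z_def shares_eq R(4)[of n] by (simp add: add_ac)
      qed
      show "summable (\<lambda>n. y (Suc n) - y n - 2 * y n * (x n - z n) / (T0 + 4 + 4 * real n))"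
        unfolding eqy using elim by simp
    qed
    then show ?case by (simp add: shares_def x_def y_def z_def)
  qed
qed

end

theorem theorem2:
  fixes P :: "'w measure"
    and G0 :: typed_graph
    and G :: "nat \<Rightarrow> 'w \<Rightarrow> typed_graph"
  assumes "wf_graph G0"
    and "\<And>t. type_degree G0 t > 0"
    and "rps_process P G0 G"
  shows "\<exists>M :: 'w \<Rightarrow> real.
    M \<in> borel_measurable P \<and>
    (AE \<omega> in P.
       (\<lambda>n. share (G n \<omega>) Rock * share (G n \<omega>) Paper * share (G n \<omega>) Scissors)
         \<longlonglongrightarrow> M \<omega>) \<and>
    (AE \<omega> in P. M \<omega> \<in> {0<..<1/27}) \<and>
    (\<forall>I. open I \<and> is_interval I \<and> I \<noteq> {} \<and> I \<subseteq> {0<..<1/27} \<longrightarrow>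
       measure (distr P borel M) I > 0) \<and>
    (AE \<omega> in P. \<not> convergent (\<lambda>n. shares (G n \<omega>))) \<and>
    (AE \<omega> in P. limit_set (\<lambda>n. shares (G n \<omega>)) =
       {(x, y, z). (x, y, z) \<in> simplex2 \<and> x * y * z = M \<omega>})"
proof -
  interpret prob_space P using assms(3) by (simp add: rps_process_def)
  interpret rps_setting P G0 G
  proof
    have "1 \<le> real (type_degree G0 t)" for t using assms(2)[of t] by simp
    then show "good G0" using assms(1) by (simp add: good_def rocks_def papers_def scissors_def)
  qed (rule assms(3))
  have range: "AE \<omega> in P. Mlim \<omega> \<in> {0<..<1/27}"
    using Mlim_pos Mlim_less by eventually_elim simp
  have conv: "AE \<omega> in P. (\<lambda>n. share (G n \<omega>) Rock * share (G n \<omega>) Paper * share (G n \<omega>) Scissors) \<longlonglongrightarrow> Mlim \<omega>"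
    using M_converges by eventually_elim (simp add: shares_eq M_def level_shares)
  have "AE \<omega> in P. \<not> convergent (\<lambda>n. shares (G n \<omega>))"
    using limit_set_shares range
  proof eventually_elim
    case (elim \<omega>)
    then show ?case using limit_set_convergent[of "\<lambda>n. shares (G n \<omega>)"] level_curve_not_singleton[of "Mlim \<omega>"]
      by auto
  qed
  then show ?thesis
    using conv range limit_set_shares Mlim_full_support
    by (intro exI[of _ Mlim]) (simp add: level_curve_def)
qed

end
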